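(* Let $(\mu,\nu,\mathcal C)$ be a Gårding–Wightman triple on $X=\mathbb Z_2^\infty$. The representation $V(\mu,\nu,\mathcal C)$ admits an invariant real form if and only if the measures $\mu$ and $\check\mu$ are equivalent, $\check\nu(x)=\nu(x)$ for almost all $x\in X$, and there exists a measurable family of operators $$r(x):V_x\to V_{\check x}\cong V_x$$ which are $\mathbb C$-antilinear, preserve the norm, and satisfy $$r(x)r(\check x)=1,\qquad r(x)c_k(\check x)=(-1)^k c_k(x)\,r(x+\delta^k)$$ for all $k\in\mathbb N$ and almost all $x\in X$.
   Context: $X=\mathbb Z_2^{\infty}$ is the compact abelian group of sequences $x=(x_1,x_2,\dots)$ of $0$'s and $1$'s with componentwise addition mod $2$, the product topology and its Borel $\sigma$-algebra. $\delta^k\in X$ ($k\ge1$) has a $1$ in position $k$ and $0$ elsewhere; $\Delta\subset X$ is the subgroup of sequences with finitely many $1$'s. $\check x=x+\mathbf 1$, $\mathbf 1=(1,1,\dots)$, interchanges all $0$'s and $1$'s; $\check f(x)=f(\check x)$ for functions and $\check\mu(A)=\mu(\check A)$ for measures, where $\check A=\{\check x:x\in A\}$. Two measures are equivalent if each has a (locally integrable) Radon–Nikodym derivative with respect to the other. A Gårding–Wightman triple $(\mu,\nu,\mathcal C)$ consists of: (1) a positive Borel measure $\mu$ on $X$, quasi-invariant under $\Delta$, i.e. for each $\delta\in\Delta$ the measure $A\mapsto\mu(A+\delta)$ is equivalent to $\mu$; (2) a family $\{V_x\}_{x\in X}$ of complex Hilbert spaces, a.e. invariant under translations by $\Delta$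 ($V_{x+\delta}=V_x$), such that $\nu(x)=\dim V_x$ is measurable (one writes $\nu$ in place of the family because changing the family unitarily yields equivalent representations); (3) a family $\mathcal C=\{c_k(x):k\ge 1,x\in X\}$ of unitary operators $c_k(x):V_x\to V_{x+\delta^k}=V_x$, depending measurably on $x$, with $c_k(x)^*=c_k(x+\delta^k)$ and $c_k(x)c_l(x+\delta^k)=c_l(x)c_k(x+\delta^l)$ for all $k,l$ and almost all $x$. The Hilbert space $V=V(\mu,\nu,\mathcal C)=\int_X^\oplus V_x\,d\mu(x)$ (representation spaces are assumed separable) carries the mutually anticommuting unitary operators of square $-I$ ($k\ge1$) $$J_kf(x)=-i(-1)^{x_1+\dots+x_{k-1}}c_k(x)\sqrt{\tfrac{d\mu(x+\delta^k)}{d\mu(x)}}f(x+\delta^k),\quad J_k'f(x)=(-1)^{x_1+\dots+x_{k}}c_k(x)\sqrt{\tfrac{d\mu(x+\delta^k)}{d\mu(x)}}f(x+\delta^k),$$ where $d\mu(x+\delta^k)/d\mu(x)$ is the Radon–Nikodym derivative of $A\mapsto\mu(A+\delta^k)$ with respect to $\mu$; they define a representation of the Clifford algebra $C(H)$ of an infinite-dimensional separable real prehilbert space $H$. $V$ admits an invariant real form if there is a $\mathbb C$-antilinear norm-preserving operator $S:V\to V$ with $S^2=I$ commuting with the action of $C(H)$, i.e. with all $J_k,J_k'$; the invariant real form is then $\{v\in V:Sv=v\}$.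
   Formalization: The spaces V_x are assumed nonzero for almost all x: if V_x = 0 throughout, the zero representation has a real form although μ and its check image need not be equivalent. The measure μ is taken to be σ-finite. *)

theory Defs
  imports
    "HOL-Analysis.Analysis"
    "HOL-Library.Z2"
    "HOL-Library.Function_Algebras"
    "HOL-Library.Extended_Nat"
begin

subsection \<open>The group of binary sequences\<close>

instantiation bit :: discrete_topology
begin
definition open_bit :: "bit set \<Rightarrow> bool" where "open_bit A \<longleftrightarrow> True"
instance by standard (simp_all add: open_bit_def)
end

text \<open>The value \<open>x n\<close> is the coordinate \<open>x\<^bsub>n+1\<^esub>\<close>: positions are counted from 1, as are the indices of
  \<open>delta\<close>, \<open>c\<close>, \<open>J\<close> and \<open>J'\<close> below. The group structure is the pointwise one, \<open>1\<close> is the constant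
  sequence, and every element is its own negative. The topology is the product topology.\<close>

type_synonym binseq = "nat \<Rightarrow> bit"

definition delta :: "nat \<Rightarrow> binseq" where
  "delta k = (\<lambda>n. if Suc n = k then 1 else 0)"

definition Delta :: "binseq set" where
  "Delta = {x. finite {n. x n = 1}}"

abbreviation check :: "binseq \<Rightarrow> binseq" where
  "check x \<equiv> x + 1"

text \<open>\<open>parity_sign m x\<close> is \<open>-1\<close> to the power \<open>x\<^sub>1 + \<dots> + x\<^sub>m\<close>.\<close>

definition parity_sign :: "nat \<Rightarrow> binseq \<Rightarrow> complex" where
  "parity_sign m x = (-1) ^ (\<Sum>n<m. of_bool (x n = 1))"


subsection \<open>Measures\<close>

text \<open>The measure \<open>A \<mapsto> \<mu>(A + a)\<close>; it is the image of \<open>\<mu>\<close> under \<open>x \<mapsto> x - a = x + a\<close>.\<close>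

definition translate :: "binseq \<Rightarrow> binseq measure \<Rightarrow> binseq measure" where
  "translate a \<mu> = distr \<mu> borel (\<lambda>x. x + a)"

abbreviation check_measure :: "binseq measure \<Rightarrow> binseq measure" where
  "check_measure \<mu> \<equiv> translate 1 \<mu>"

definition has_derivative_wrt :: "'a measure \<Rightarrow> 'a measure \<Rightarrow> bool" where
  "has_derivative_wrt N M \<longleftrightarrow>
     (\<exists>f :: 'a \<Rightarrow> real. f \<in> borel_measurable M \<and> (\<forall>x. 0 \<le> f x) \<and> N = density M (\<lambda>x. ennreal (f x)))"

text \<open>For finite measures on a compact space the derivatives are automatically integrable, hence
  locally integrable. For an infinite measure this cannot be asked for (the derivative of the
  measure with respect to itself is 1), so only finite-valued derivatives are required.\<close>

definition equivalent_measures :: "'a measure \<Rightarrow> 'a measure \<Rightarrow> bool" where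
  "equivalent_measures M N \<longleftrightarrow> has_derivative_wrt N M \<and> has_derivative_wrt M N"


subsection \<open>Complex Hilbert spaces\<close>

text \<open>The inner product is antilinear in the first argument. Its real part is the real inner product
  of the underlying real Hilbert space, so norm and topology are the usual ones.\<close>

class complex_hilbert_space = real_inner + complete_space +
  fixes scaleC :: "complex \<Rightarrow> 'a \<Rightarrow> 'a" (infixr \<open>*\<^sub>C\<close> 75)
    and cinner :: "'a \<Rightarrow> 'a \<Rightarrow> complex"
  assumes scaleC_add_right: "a *\<^sub>C (u + v) = a *\<^sub>C u + a *\<^sub>C v"
    and scaleC_add_left: "(a + b) *\<^sub>C u = a *\<^sub>C u + b *\<^sub>C u"
    and scaleC_scaleC: "a *\<^sub>C (b *\<^sub>C u) = (a * b) *\<^sub>C u"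
    and scaleC_of_real: "complex_of_real t *\<^sub>C u = t *\<^sub>R u"
    and cinner_commute: "cinner u v = cnj (cinner v u)"
    and cinner_add_right: "cinner u (v + w) = cinner u v + cinner u w"
    and cinner_scaleC_right: "cinner u (a *\<^sub>C v) = a * cinner u v"
    and inner_eq_Re_cinner: "inner u v = Re (cinner u v)"

global_interpretation complex_vector: vector_space "scaleC :: complex \<Rightarrow> 'a \<Rightarrow> 'a::complex_hilbert_space"
proof unfold_locales
  fix u :: 'a
  show "1 *\<^sub>C u = u" using scaleC_of_real[of 1 u] by simp
qed (simp_all add: scaleC_add_right scaleC_add_left scaleC_scaleC)

definition hilbert_subspace :: "'h::complex_hilbert_space set \<Rightarrow> bool" where
  "hilbert_subspace W \<longleftrightarrow> closed W \<and> complex_vector.subspace W"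

definition orthonormal_basis :: "'h::complex_hilbert_space set \<Rightarrow> 'h set \<Rightarrow> bool" where
  "orthonormal_basis W B \<longleftrightarrow> B \<subseteq> W \<and>
     (\<forall>u\<in>B. \<forall>v\<in>B. cinner u v = (if u = v then 1 else 0)) \<and>
     closure (complex_vector.span B) = W"

text \<open>The dimension of a separable Hilbert space; all infinite dimensions are identified.\<close>

definition hilbert_dim :: "'h::complex_hilbert_space set \<Rightarrow> enat" where
  "hilbert_dim W = (THE d. \<exists>B. orthonormal_basis W B \<and> d = (if finite B then enat (card B) else \<infinity>))"

definition unitary_between ::
  "'h::complex_hilbert_space set \<Rightarrow> 'h set \<Rightarrow> ('h \<Rightarrow> 'h) \<Rightarrow> bool" where
  "unitary_between W W' T \<longleftrightarrow> T ` W = W' \<and>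
     (\<forall>u\<in>W. \<forall>v\<in>W. \<forall>a b. T (a *\<^sub>C u + b *\<^sub>C v) = a *\<^sub>C T u + b *\<^sub>C T v) \<and>
     (\<forall>u\<in>W. \<forall>v\<in>W. cinner (T u) (T v) = cinner u v)"

definition antilinear_isometry_between ::
  "'h::complex_hilbert_space set \<Rightarrow> 'h set \<Rightarrow> ('h \<Rightarrow> 'h) \<Rightarrow> bool" where
  "antilinear_isometry_between W W' T \<longleftrightarrow> T ` W \<subseteq> W' \<and>
     (\<forall>u\<in>W. \<forall>v\<in>W. \<forall>a b. T (a *\<^sub>C u + b *\<^sub>C v) = cnj a *\<^sub>C T u + cnj b *\<^sub>C T v) \<and>
     (\<forall>u\<in>W. norm (T u) = norm u)"


subsection \<open>Measurable families of Hilbert spaces\<close>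

text \<open>The spaces \<open>V x\<close> are closed subspaces of one ambient space, which need not be separable. As usual
  for direct integrals, the measurable structure is given by a fundamental sequence \<open>e\<close> of sections,
  whose values span a dense subspace of each \<open>V x\<close> (so each \<open>V x\<close> is separable). Measurability is
  understood up to null sets, hence the completion of \<open>\<mu>\<close>.\<close>

definition measurable_family ::
  "binseq measure \<Rightarrow> (binseq \<Rightarrow> 'h::complex_hilbert_space set) \<Rightarrow> (nat \<Rightarrow> binseq \<Rightarrow> 'h) \<Rightarrow> bool" where
  "measurable_family \<mu> V e \<longleftrightarrow>
     (\<forall>x. hilbert_subspace (V x)) \<and>
     (\<forall>m n. (\<lambda>x. cinner (e m x) (e n x)) \<in> borel_measurable (completion \<mu>)) \<and>
     (\<forall>x. closure (complex_vector.span (range (\<lambda>n. e n x))) = V x)"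

definition msections ::
  "binseq measure \<Rightarrow> (binseq \<Rightarrow> 'h::complex_hilbert_space set) \<Rightarrow> (nat \<Rightarrow> binseq \<Rightarrow> 'h) \<Rightarrow>
   (binseq \<Rightarrow> 'h) set" where
  "msections \<mu> V e = {f. (AE x in \<mu>. f x \<in> V x) \<and>
     (\<forall>n. (\<lambda>x. cinner (e n x) (f x)) \<in> borel_measurable (completion \<mu>))}"

text \<open>The direct integral of the \<open>V x\<close> is the space of square integrable sections modulo equality
  almost everywhere. Its elements are represented by sections; operators on it are operators on
  sections that are compatible with equality almost everywhere.\<close>

definition L2_sections ::
  "binseq measure \<Rightarrow> (binseq \<Rightarrow> 'h::complex_hilbert_space set) \<Rightarrow> (nat \<Rightarrow> binseq \<Rightarrow> 'h) \<Rightarrow>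
   (binseq \<Rightarrow> 'h) set" where
  "L2_sections \<mu> V e =
     {f \<in> msections \<mu> V e. integrable (completion \<mu>) (\<lambda>x. (norm (f x))\<^sup>2)}"

definition L2_norm :: "binseq measure \<Rightarrow> (binseq \<Rightarrow> 'h::complex_hilbert_space) \<Rightarrow> real" where
  "L2_norm \<mu> f = sqrt (\<integral>x. (norm (f x))\<^sup>2 \<partial>completion \<mu>)"


subsection \<open>Garding--Wightman triples\<close>

abbreviation nu :: "(binseq \<Rightarrow> 'h::complex_hilbert_space set) \<Rightarrow> binseq \<Rightarrow> enat" where
  "nu V x \<equiv> hilbert_dim (V x)"

text \<open>The measure is assumed \<open>\<sigma>\<close>-finite, so that Radon--Nikodym derivatives make sense. The spaces
  \<open>V x\<close> are nonzero almost everywhere (\<open>nu\<close> has values in \<open>{1, 2, \<dots>, \<infinity>}\<close>), since otherwise the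
  representation does not see all of \<open>\<mu>\<close>. Invariance of the family under \<open>Delta\<close> includes
  invariance of its measurable structure.\<close>

definition GW_triple ::
  "binseq measure \<Rightarrow> (binseq \<Rightarrow> 'h::complex_hilbert_space set) \<Rightarrow> (nat \<Rightarrow> binseq \<Rightarrow> 'h) \<Rightarrow>
   (nat \<Rightarrow> binseq \<Rightarrow> 'h \<Rightarrow> 'h) \<Rightarrow> bool" where
  "GW_triple \<mu> V e c \<longleftrightarrow>
     sets \<mu> = sets borel \<and> sigma_finite_measure \<mu> \<and>
     (\<forall>d\<in>Delta. equivalent_measures (translate d \<mu>) \<mu>) \<and>
     measurable_family \<mu> V e \<and>
     (AE x in \<mu>. V x \<noteq> {0}) \<and>
     (\<forall>d\<in>Delta. AE x in \<mu>. V (x + d) = V x) \<and>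
     (\<forall>d\<in>Delta. \<forall>f\<in>msections \<mu> V e. (\<lambda>x. f (x + d)) \<in> msections \<mu> V e) \<and>
     nu V \<in> measurable (completion \<mu>) (count_space UNIV) \<and>
     (\<forall>k\<ge>1. AE x in \<mu>. unitary_between (V x) (V (x + delta k)) (c k x)) \<and>
     (\<forall>k\<ge>1. \<forall>f\<in>msections \<mu> V e. (\<lambda>x. c k x (f x)) \<in> msections \<mu> V e) \<and>
     (\<forall>k\<ge>1. AE x in \<mu>. \<forall>u\<in>V x. \<forall>v\<in>V x. cinner (c k x u) v = cinner u (c k (x + delta k) v)) \<and>
     (\<forall>k\<ge>1. \<forall>l\<ge>1. AE x in \<mu>. \<forall>v\<in>V x.
        c k x (c l (x + delta k) v) = c l x (c k (x + delta l) v))"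

definition sqrt_deriv :: "binseq measure \<Rightarrow> nat \<Rightarrow> binseq \<Rightarrow> real" where
  "sqrt_deriv \<mu> k x = sqrt (enn2real (RN_deriv \<mu> (translate (delta k) \<mu>) x))"

definition J ::
  "binseq measure \<Rightarrow> (nat \<Rightarrow> binseq \<Rightarrow> 'h \<Rightarrow> 'h) \<Rightarrow> nat \<Rightarrow>
   (binseq \<Rightarrow> 'h::complex_hilbert_space) \<Rightarrow> binseq \<Rightarrow> 'h" where
  "J \<mu> c k f x = (- \<i> * parity_sign (k - 1) x) *\<^sub>C c k x (sqrt_deriv \<mu> k x *\<^sub>R f (x + delta k))"

definition J' ::
  "binseq measure \<Rightarrow> (nat \<Rightarrow> binseq \<Rightarrow> 'h \<Rightarrow> 'h) \<Rightarrow> nat \<Rightarrow>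
   (binseq \<Rightarrow> 'h::complex_hilbert_space) \<Rightarrow> binseq \<Rightarrow> 'h" where
  "J' \<mu> c k f x = parity_sign k x *\<^sub>C c k x (sqrt_deriv \<mu> k x *\<^sub>R f (x + delta k))"


subsection \<open>Invariant real forms\<close>

definition real_structure ::
  "binseq measure \<Rightarrow> (binseq \<Rightarrow> 'h::complex_hilbert_space set) \<Rightarrow> (nat \<Rightarrow> binseq \<Rightarrow> 'h) \<Rightarrow>
   (nat \<Rightarrow> binseq \<Rightarrow> 'h \<Rightarrow> 'h) \<Rightarrow> ((binseq \<Rightarrow> 'h) \<Rightarrow> (binseq \<Rightarrow> 'h)) \<Rightarrow> bool" where
  "real_structure \<mu> V e c S \<longleftrightarrow>
     (\<forall>f\<in>L2_sections \<mu> V e. S f \<in> L2_sections \<mu> V e) \<and>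
     (\<forall>f\<in>L2_sections \<mu> V e. \<forall>g\<in>L2_sections \<mu> V e.
        (AE x in \<mu>. f x = g x) \<longrightarrow> (AE x in \<mu>. S f x = S g x)) \<and>
     (\<forall>f\<in>L2_sections \<mu> V e. \<forall>g\<in>L2_sections \<mu> V e. \<forall>a b. AE x in \<mu>.
        S (\<lambda>y. a *\<^sub>C f y + b *\<^sub>C g y) x = cnj a *\<^sub>C S f x + cnj b *\<^sub>C S g x) \<and>
     (\<forall>f\<in>L2_sections \<mu> V e. L2_norm \<mu> (S f) = L2_norm \<mu> f) \<and>
     (\<forall>f\<in>L2_sections \<mu> V e. AE x in \<mu>. S (S f) x = f x) \<and>
     (\<forall>k\<ge>1. \<forall>f\<in>L2_sections \<mu> V e. AE x in \<mu>. S (J \<mu> c k f) x = J \<mu> c k (S f) x) \<and>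
     (\<forall>k\<ge>1. \<forall>f\<in>L2_sections \<mu> V e. AE x in \<mu>. S (J' \<mu> c k f) x = J' \<mu> c k (S f) x)"

definition admits_invariant_real_form ::
  "binseq measure \<Rightarrow> (binseq \<Rightarrow> 'h::complex_hilbert_space set) \<Rightarrow> (nat \<Rightarrow> binseq \<Rightarrow> 'h) \<Rightarrow>
   (nat \<Rightarrow> binseq \<Rightarrow> 'h \<Rightarrow> 'h) \<Rightarrow> bool" where
  "admits_invariant_real_form \<mu> V e c \<longleftrightarrow> (\<exists>S. real_structure \<mu> V e c S)"

text \<open>In the relation \<open>r(x) c\<^sub>k(check x) = \<plusminus> c\<^sub>k(x) r(x + delta k)\<close> the operator \<open>c\<^sub>k(check x)\<close> acts on
  \<open>V (check x)\<close> and \<open>c\<^sub>k(x)\<close> acts on \<open>V x\<close>. So, when \<open>V (check x)\<close> and \<open>V x\<close> are isomorphic but not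
  identified, \<open>r x\<close> maps \<open>V (check x)\<close> to \<open>V x\<close>.\<close>

definition check_antilinear_family ::
  "binseq measure \<Rightarrow> (binseq \<Rightarrow> 'h::complex_hilbert_space set) \<Rightarrow> (nat \<Rightarrow> binseq \<Rightarrow> 'h) \<Rightarrow>
   (binseq \<Rightarrow> 'h \<Rightarrow> 'h) \<Rightarrow> bool" where
  "check_antilinear_family \<mu> V e r \<longleftrightarrow>
     (AE x in \<mu>. antilinear_isometry_between (V (check x)) (V x) (r x)) \<and>
     (\<forall>f\<in>msections \<mu> V e. (\<lambda>x. r x (f (check x))) \<in> msections \<mu> V e)"

end

theory Submission
  imports Defs
begin

text \<open>The composite \<open>J\<^sub>k J'\<^sub>k\<close> is multiplication by \<open>\<plusminus>\<i>\<close>, the sign depending on \<open>x\<^sub>k\<close> only. Hence an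
  antilinear \<open>S\<close> commuting with \<open>C(H)\<close> carries sections supported on a cylinder to sections supported
  on its image under \<open>check\<close>, and since it preserves norms, the measures \<open>\<parallel>S f\<parallel>\<^sup>2 \<mu>\<close> and the image of
  \<open>\<parallel>f\<parallel>\<^sup>2 \<mu>\<close> under \<open>check\<close> agree on cylinders, so on all Borel sets. This gives the equivalence of \<open>\<mu>\<close>
  and its image, and with \<open>p\<close> the density of the image it gives \<open>\<parallel>S f(x)\<parallel>\<^sup>2 = p(x) \<parallel>f(check x)\<parallel>\<^sup>2\<close>
  almost everywhere. So \<open>S f(x) = sqrt (p(x)) r(x) f(check x)\<close> for antiunitary operators \<open>r(x)\<close>, and
  the relations for \<open>r\<close> translate into \<open>S\<^sup>2 = 1\<close> and the commutation of \<open>S\<close> with the \<open>J'\<^sub>k\<close> (the \<open>J\<^sub>k\<close>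
  give the same relation). Conversely this formula turns a family \<open>r\<close> into an operator \<open>S\<close>.\<close>

subsection \<open>Complex Hilbert spaces\<close>

text \<open>The map \<open>check\<close> comes from complex conjugation: an antilinear
  \<open>S\<close> turns \<i> into -\<i>, and in the multiplier \<plusminus>\<i> this amounts to
  interchanging the two values of the coordinate. The factor (-1)^k in the relation for
  \<open>r\<close> is the change of \<open>parity_sign k\<close> under \<open>check\<close>. The
  main obstacle is that \<open>S\<close> acts on sections modulo null sets: every identity for
  \<open>S f\<close> fails on a null set depending on \<open>f\<close>, while \<open>r x\<close> has
  to be a single operator on the whole of \<open>V (check x)\<close>. Hence identities are first
  proved for countably many sections spanning every fibre, whose exceptional sets can be united, and
  are then extended inside each fibre by antilinearity and continuity. Polarization turns the
  pointwise norm identity into one for inner products, so the Gram matrix of the images of these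
  sections is known; this is what makes \<open>r x\<close> well defined. As \<open>\<mu>\<close> may
  be infinite, it is compared with its image through the finite measures with density
  \<open>(norm (f x))\<^sup>2\<close>. That the fibres are nonzero almost everywhere ensures that
  these measures together detect every null set.\<close>

lemma cinner_add_left: "cinner (u + v) w = cinner u w + cinner v (w::'h::complex_hilbert_space)"
  by (simp add: cinner_commute[of _ w] cinner_add_right)

lemma cinner_scaleC_left: "cinner (a *\<^sub>C u) (v::'h::complex_hilbert_space) = cnj a * cinner u v"
  by (simp add: cinner_commute[of _ v] cinner_scaleC_right)

lemma scaleC_minus1: "(-1) *\<^sub>C (u::'h::complex_hilbert_space) = - u"
  using scaleC_of_real[of "-1" u] by simp

lemma cinner_minus_right: "cinner u (- v) = - cinner u (v::'h::complex_hilbert_space)"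
  using cinner_scaleC_right[of u "-1" v] by (simp add: scaleC_minus1)

lemma cinner_diff_right: "cinner u (v - w) = cinner u v - cinner u (w::'h::complex_hilbert_space)"
  using cinner_add_right[of u v "- w"] by (simp add: cinner_minus_right)

lemma cinner_diff_left: "cinner (u - v) w = cinner u w - cinner v (w::'h::complex_hilbert_space)"
  by (simp add: cinner_commute[of _ w] cinner_diff_right)

lemma cinner_zero_right [simp]: "cinner u (0::'h::complex_hilbert_space) = 0"
  using cinner_diff_right[of u 0 0] by simp

lemma cinner_zero_left [simp]: "cinner (0::'h::complex_hilbert_space) u = 0"
  using cinner_diff_left[of 0 0 u] by simp

lemma cinner_scaleR_right: "cinner u (t *\<^sub>R v) = complex_of_real t * cinner u (v::'h::complex_hilbert_space)"
  by (simp only: cinner_scaleC_right flip: scaleC_of_real)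

lemma cinner_sum_right: "cinner u (\<Sum>i\<in>I. v i :: 'h::complex_hilbert_space) = (\<Sum>i\<in>I. cinner u (v i))"
  by (induction I rule: infinite_finite_induct) (simp_all add: cinner_add_right)

lemma cinner_sum_left: "cinner (\<Sum>i\<in>I. v i) (u::'h::complex_hilbert_space) = (\<Sum>i\<in>I. cinner (v i) u)"
  by (induction I rule: infinite_finite_induct) (simp_all add: cinner_add_left)

lemma cinner_self: "cinner v v = complex_of_real ((norm (v::'h::complex_hilbert_space))\<^sup>2)"
proof -
  have "Im (cinner v v) = 0"
    using arg_cong[OF cinner_commute[of v v], of Im] by simp
  moreover have "Re (cinner v v) = (norm v)\<^sup>2"
    by (simp flip: inner_eq_Re_cinner add: power2_norm_eq_inner)
  ultimately show ?thesis by (simp add: complex_eq_iff)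
qed

lemma norm_scaleC: "norm (a *\<^sub>C v) = cmod a * norm (v::'h::complex_hilbert_space)"
proof -
  have "cnj a * a = complex_of_real ((cmod a)\<^sup>2)"
    by (metis complex_norm_square mult.commute)
  then have "cinner (a *\<^sub>C v) (a *\<^sub>C v) = complex_of_real ((cmod a)\<^sup>2) * cinner v v"
    by (simp only: cinner_scaleC_left cinner_scaleC_right mult.assoc[symmetric] mult.commute[of a "cnj a"])
  then have "cinner (a *\<^sub>C v) (a *\<^sub>C v) = complex_of_real ((cmod a)\<^sup>2 * (norm v)\<^sup>2)"
    by (simp only: cinner_self of_real_mult)
  then have "(norm (a *\<^sub>C v))\<^sup>2 = (cmod a * norm v)\<^sup>2"
    unfolding cinner_self of_real_eq_iff by (simp add: power_mult_distrib)
  then show ?thesis by (simp add: power2_eq_iff_nonneg)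
qed

text \<open>A phase \<open>a\<close> turns \<open>cinner u v\<close> into its absolute value; the
  real Cauchy-Schwarz inequality for \<open>u\<close> and \<open>a *\<^sub>C v\<close> does the
  rest.\<close>

lemma cinner_bound: "cmod (cinner u v) \<le> norm u * norm (v::'h::complex_hilbert_space)"
proof (cases "cinner u v = 0")
  case False
  define a where "a = cnj (cinner u v) / cmod (cinner u v)"
  have a: "cmod a = 1" using False by (simp add: a_def norm_divide)
  have "a * cinner u v = complex_of_real (cmod (cinner u v))"
    using False by (simp add: a_def complex_norm_square[symmetric] mult.commute power2_eq_square)
  then have "cmod (cinner u v) = inner u (a *\<^sub>C v)"
    by (simp add: inner_eq_Re_cinner cinner_scaleC_right)
  also have "\<dots> \<le> norm u * norm (a *\<^sub>C v)" by (rule norm_cauchy_schwarz)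
  finally show ?thesis by (simp add: norm_scaleC a)
qed simp

lemma bounded_linear_cinner_right: "bounded_linear (\<lambda>v. cinner u (v::'h::complex_hilbert_space))"
  by (rule bounded_linear_intro[where K = "norm u"])
     (use cinner_bound[of u] in \<open>simp_all add: cinner_add_right cinner_scaleR_right scaleR_conv_of_real mult.commute\<close>)

lemma bounded_linear_cinner_left: "bounded_linear (\<lambda>v. cinner (v::'h::complex_hilbert_space) u)"
proof -
  have "(\<lambda>v. cinner v u) = (\<lambda>v. cnj (cinner u v))" by (rule ext, rule cinner_commute)
  then show ?thesis
    using bounded_linear_compose[OF bounded_linear_cnj bounded_linear_cinner_right] by simp
qed

lemma bounded_linear_scaleC_right: "bounded_linear (\<lambda>v. a *\<^sub>C (v::'h::complex_hilbert_space))"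
proof (rule bounded_linear_intro[where K = "cmod a"])
  show "a *\<^sub>C (r *\<^sub>R v) = r *\<^sub>R (a *\<^sub>C v)" for r and v :: 'h
    unfolding scaleC_of_real[symmetric] scaleC_scaleC by (simp only: mult.commute)
qed (simp_all add: scaleC_add_right norm_scaleC)

lemma tendsto_cinner_left:
  "(f \<longlongrightarrow> v) F \<Longrightarrow> ((\<lambda>x. cinner (f x) (u::'h::complex_hilbert_space)) \<longlongrightarrow> cinner v u) F"
  using bounded_linear.tendsto[OF bounded_linear_cinner_left] .

lemma tendsto_cinner_right:
  "(f \<longlongrightarrow> v) F \<Longrightarrow> ((\<lambda>x. cinner u (f x :: 'h::complex_hilbert_space)) \<longlongrightarrow> cinner u v) F"
  using bounded_linear.tendsto[OF bounded_linear_cinner_right] .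

lemma tendsto_scaleC:
  "(f \<longlongrightarrow> v) F \<Longrightarrow> ((\<lambda>x. a *\<^sub>C (f x :: 'h::complex_hilbert_space)) \<longlongrightarrow> a *\<^sub>C v) F"
  using bounded_linear.tendsto[OF bounded_linear_scaleC_right] .

lemma cinner_eq_inner:
  "cinner u v = Complex (inner u v) (inner (\<i> *\<^sub>C u) (v::'h::complex_hilbert_space))"
  by (simp add: inner_eq_Re_cinner cinner_scaleC_left complex_eq_iff)

text \<open>The imaginary part is the real inner product of \<open>\<i> *\<^sub>C u\<close> with
  \<open>v\<close>, the first argument being antilinear. Measurability of inner products and the
  passage from isometry to inner products both rest on this formula.\<close>

lemma cinner_norm_polarization:
  "cinner u v = Complex (((norm (u + v))\<^sup>2 - (norm u)\<^sup>2 - (norm v)\<^sup>2) / 2)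
     (((norm (\<i> *\<^sub>C u + v))\<^sup>2 - (norm u)\<^sup>2 - (norm (v::'h::complex_hilbert_space))\<^sup>2) / 2)"
  by (simp add: cinner_eq_inner power2_norm_eq_inner inner_add_left inner_add_right inner_commute)
     (simp add: inner_eq_Re_cinner cinner_scaleC_left cinner_scaleC_right)

section \<open>Closed spans and antiunitary extension\<close>

lemma subspace_closure_span: "complex_vector.subspace (closure (complex_vector.span (B::'h::complex_hilbert_space set)))"
proof (rule complex_vector.subspaceI)
  show "0 \<in> closure (complex_vector.span B)"
    using closure_subset complex_vector.span_zero by blast
next
  fix u v assume "u \<in> closure (complex_vector.span B)" "v \<in> closure (complex_vector.span B)"
  then obtain p q where "\<And>n. p n \<in> complex_vector.span B" "p \<longlonglongrightarrow> u" "\<And>n. q n \<in> complex_vector.span B" "q \<longlonglongrightarrow> v"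
    unfolding closure_sequential by metis
  then show "u + v \<in> closure (complex_vector.span B)"
    unfolding closure_sequential
    by (intro exI[of _ "\<lambda>n. p n + q n"]) (auto intro: tendsto_add complex_vector.span_add)
next
  fix a u assume "u \<in> closure (complex_vector.span B)"
  then obtain p where "\<And>n. p n \<in> complex_vector.span B" "p \<longlonglongrightarrow> u"
    unfolding closure_sequential by metis
  then show "a *\<^sub>C u \<in> closure (complex_vector.span B)"
    unfolding closure_sequential
    by (intro exI[of _ "\<lambda>n. a *\<^sub>C p n"]) (auto intro: tendsto_scaleC complex_vector.span_scale)
qed

text \<open>Coefficients are attached to indices rather than to vectors, so that \<open>f\<close>
  may repeat values and the same coefficients can be used with another sequence.\<close>

lemma span_range_finite_sum:
  assumes "v \<in> complex_vector.span (range (f :: nat \<Rightarrow> 'h::complex_hilbert_space))"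
  obtains N a where "v = (\<Sum>i<N. a i *\<^sub>C f i)"
proof -
  have "\<exists>N a. v = (\<Sum>i<N. a i *\<^sub>C f i)"
    using assms
  proof (induction rule: complex_vector.span_induct_alt)
    case base
    show ?case by (rule exI[of _ 0]) simp
  next
    case (step b x y)
    then obtain N a j where Na: "y = (\<Sum>i<N. a i *\<^sub>C f i)" and j: "x = f j" by blast
    define M where "M = max N (Suc j)"
    define a' where "a' i = (if i < N then a i else 0) + (if i = j then b else 0)" for i
    have "(\<Sum>i<M. a' i *\<^sub>C f i)
        = (\<Sum>i<M. (if i < N then a i else 0) *\<^sub>C f i) + (\<Sum>i<M. (if i = j then b else 0) *\<^sub>C f i)"
      by (simp add: a'_def scaleC_add_left sum.distrib)
    also have "(\<Sum>i<M. (if i < N then a i else 0) *\<^sub>C f i) = (\<Sum>i<N. a i *\<^sub>C f i)"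
      by (rule sum.mono_neutral_cong_right) (auto simp: M_def)
    also have "(\<Sum>i<M. (if i = j then b else 0) *\<^sub>C f i) = (\<Sum>i\<in>{j}. b *\<^sub>C f i)"
      by (rule sum.mono_neutral_cong_right) (auto simp: M_def)
    finally show ?case using Na j by (intro exI[of _ M] exI[of _ a']) (simp add: add.commute)
  qed
  then show ?thesis using that by blast
qed

lemma cinner_zero_on_closure_span:
  assumes "\<And>b. b \<in> B \<Longrightarrow> cinner b (w::'h::complex_hilbert_space) = 0"
    and "u \<in> closure (complex_vector.span B)"
  shows "cinner u w = 0"
proof -
  have *: "cinner p w = 0" if "p \<in> complex_vector.span B" for p
    using that
    by (induction rule: complex_vector.span_induct_alt)
       (simp_all add: assms(1) cinner_add_left cinner_scaleC_left)
  obtain p where p: "\<And>n. p n \<in> complex_vector.span B" "p \<longlonglongrightarrow> u"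
    using assms(2) unfolding closure_sequential by metis
  have "(\<lambda>n. cinner (p n) w) \<longlonglongrightarrow> cinner u w" by (rule tendsto_cinner_left[OF p(2)])
  then show ?thesis using * p(1) by (simp add: LIMSEQ_const_iff)
qed

text \<open>The difference lies in the closed span and is orthogonal to it, hence to itself. This is
  the uniqueness principle used in the fibres.\<close>

lemma closure_span_eqI:
  assumes "u \<in> closure (complex_vector.span B)" "v \<in> closure (complex_vector.span B)"
    and "\<And>b. b \<in> B \<Longrightarrow> cinner b u = cinner b (v::'h::complex_hilbert_space)"
  shows "u = v"
proof -
  have "u - v \<in> closure (complex_vector.span B)"
    by (rule complex_vector.subspace_diff[OF subspace_closure_span assms(1,2)])
  from cinner_zero_on_closure_span[OF _ this, of "u - v"] assms(3)
  have "cinner (u - v) (u - v) = 0" by (simp add: cinner_diff_right)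
  then show ?thesis by (simp add: cinner_self)
qed

text \<open>The extension sends \<open>v\<close> to the unique \<open>w\<close> in the closed span of the \<open>g n\<close> with
  \<open>cinner (g n) w = cinner v (f n)\<close>.\<close>

lemma antiunitary_extension:
  fixes f g :: "nat \<Rightarrow> 'h::complex_hilbert_space"
  assumes gram: "\<And>m n. cinner (g m) (g n) = cinner (f n) (f m)"
  shows "\<exists>R. antilinear_isometry_between (closure (complex_vector.span (range f)))
            (closure (complex_vector.span (range g))) R \<and>
          (\<forall>v\<in>closure (complex_vector.span (range f)). \<forall>n. cinner (g n) (R v) = cinner v (f n)) \<and>
          (\<forall>n. R (f n) = g n)"
proof -
  let ?F = "complex_vector.span (range f)" and ?G = "complex_vector.span (range g)"
  define rel where "rel v w \<longleftrightarrow> w \<in> closure ?G \<and> (\<forall>n. cinner (g n) w = cinner v (f n))" for v w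
  have uniq: "w = w'" if "rel v w" "rel v w'" for v w w'
    using that by (intro closure_span_eqI[of _ "range g"]) (auto simp: rel_def)
  have comb: "rel (a *\<^sub>C v + b *\<^sub>C v') (cnj a *\<^sub>C w + cnj b *\<^sub>C w')" if "rel v w" "rel v' w'" for a b v v' w w'
    using that unfolding rel_def
    by (auto simp: cinner_add_left cinner_add_right cinner_scaleC_left cinner_scaleC_right
        intro!: complex_vector.subspace_add[OF subspace_closure_span] complex_vector.subspace_scale[OF subspace_closure_span])
  have span_ex: "\<exists>w. rel v w \<and> norm w = norm v" if v: "v \<in> ?F" for v
  proof -
    from v obtain N a where Na: "v = (\<Sum>i<N. a i *\<^sub>C f i)" by (rule span_range_finite_sum)
    \<comment> \<open>Antilinearity forces the conjugated coefficients. They depend on the chosen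
      representation of \<open>v\<close>, but the inner products of \<open>w\<close> with all
      \<open>g n\<close> depend on \<open>v\<close> only.\<close>
    define w where "w = (\<Sum>i<N. cnj (a i) *\<^sub>C g i)"
    have "w \<in> ?G" unfolding w_def
      by (intro complex_vector.span_sum complex_vector.span_scale complex_vector.span_base) auto
    then have wc: "w \<in> closure ?G" using closure_subset by blast
    have w: "cinner (g n) w = cinner v (f n)" for n
      by (simp add: w_def Na cinner_sum_left cinner_sum_right cinner_scaleC_left cinner_scaleC_right gram)
    have "cinner w w = (\<Sum>i<N. a i * cinner v (f i))"
      by (subst (1) w_def) (simp add: cinner_sum_left cinner_scaleC_left w)
    also have "\<dots> = cinner v v"
      by (subst (3) Na) (simp add: cinner_sum_right cinner_scaleC_right)
    finally have "norm w = norm v"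
      unfolding cinner_self of_real_eq_iff by (simp add: power2_eq_iff_nonneg)
    with w wc show ?thesis by (auto simp: rel_def)
  qed
  have ex: "\<exists>w. rel v w \<and> norm w = norm v" if v: "v \<in> closure ?F" for v
  proof -
    obtain p where p: "\<And>n. p n \<in> ?F" "p \<longlonglongrightarrow> v"
      using v unfolding closure_sequential by metis
    obtain q where q: "\<And>n. rel (p n) (q n)" using span_ex[OF p(1)] by metis
    \<comment> \<open>\<open>rel\<close> passes to differences and determines its second argument,
      so the norm equality on the span applies to \<open>q m - q n\<close>; thus \<open>q\<close>
      inherits the Cauchy property of \<open>p\<close>.\<close>
    have dist: "norm (q m - q n) = norm (p m - p n)" for m n
    proof -
      have "rel (p m - p n) (q m - q n)"
        using comb[OF q[of m] q[of n], of 1 "-1"] by (simp add: scaleC_minus1)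
      moreover have "p m - p n \<in> ?F" by (intro complex_vector.span_diff p)
      ultimately show ?thesis using span_ex uniq by blast
    qed
    have "Cauchy p" using p(2) LIMSEQ_imp_Cauchy by blast
    then have "Cauchy q" unfolding Cauchy_def dist_norm dist .
    then obtain w where w: "q \<longlonglongrightarrow> w" using Cauchy_convergent convergent_def by blast
    have "w \<in> closure ?G"
      using w q by (meson closed_closure closed_sequentially rel_def)
    moreover have "cinner (g n) w = cinner v (f n)" for n
    proof (rule LIMSEQ_unique)
      show "(\<lambda>m. cinner (g n) (q m)) \<longlonglongrightarrow> cinner (g n) w" by (rule tendsto_cinner_right[OF w])
      show "(\<lambda>m. cinner (g n) (q m)) \<longlonglongrightarrow> cinner v (f n)"
        using q tendsto_cinner_left[OF p(2)] by (simp add: rel_def)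
    qed
    moreover have "norm w = norm v"
    proof (rule LIMSEQ_unique)
      show "(\<lambda>m. norm (q m)) \<longlonglongrightarrow> norm w" by (rule tendsto_norm[OF w])
      have "norm (q m) = norm (p m)" for m using span_ex[OF p(1)] uniq q by blast
      then show "(\<lambda>m. norm (q m)) \<longlonglongrightarrow> norm v" using tendsto_norm[OF p(2)] by simp
    qed
    ultimately show ?thesis by (auto simp: rel_def)
  qed
  then obtain R where R: "\<And>v. v \<in> closure ?F \<Longrightarrow> rel v (R v) \<and> norm (R v) = norm v" by metis
  have sub: "a *\<^sub>C u + b *\<^sub>C v \<in> closure ?F" if "u \<in> closure ?F" "v \<in> closure ?F" for a b u v
    by (intro complex_vector.subspace_add[OF subspace_closure_span] complex_vector.subspace_scale[OF subspace_closure_span] that)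
  have "antilinear_isometry_between (closure ?F) (closure ?G) R"
    unfolding antilinear_isometry_between_def
  proof (intro conjI ballI allI)
    show "R ` closure ?F \<subseteq> closure ?G" using R by (auto simp: rel_def)
    show "R (a *\<^sub>C u + b *\<^sub>C v) = cnj a *\<^sub>C R u + cnj b *\<^sub>C R v"
      if "u \<in> closure ?F" "v \<in> closure ?F" for a b u v
      using uniq[OF conjunct1[OF R[OF sub[OF that]]] comb[OF conjunct1[OF R[OF that(1)]] conjunct1[OF R[OF that(2)]]]] .
  qed (use R in auto)
  moreover have "R (f n) = g n" for n
  proof -
    have "f n \<in> closure ?F" "g n \<in> closure ?G"
      by (auto intro!: subsetD[OF closure_subset] complex_vector.span_base)
    then show ?thesis using uniq[of "f n" "R (f n)" "g n"] R gram by (auto simp: rel_def)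
  qed
  ultimately show ?thesis using R by (intro exI[of _ R]) (auto simp: rel_def)
qed

subsection \<open>Null sets, densities and translations\<close>

instance bit :: finite
proof
  have "(UNIV :: bit set) = {0, 1}"
  proof (intro set_eqI iffI)
    show "b \<in> {0, 1}" for b :: bit by (cases b) simp_all
  qed simp
  then show "finite (UNIV :: bit set)" by (metis finite.emptyI finite_insert)
qed

instance bit :: second_countable_topology
proof
  show "\<exists>B::bit set set. countable B \<and> open = generate_topology B"
  proof (intro exI[of _ UNIV] conjI ext)
    show "countable (UNIV :: bit set set)" by (rule countable_finite) simp
    show "open A = generate_topology UNIV A" for A :: "bit set"
      by (simp add: open_discrete generate_topology.Basis)
  qed
qed

lemma bit_add_self [simp]: "b + b = (0::bit)"
  by (cases b) simp_all

lemma binseq_add_self [simp]: "x + x = (0::binseq)"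
  by (rule ext) simp

lemma binseq_add_cancel [simp]: "x + a + a = (x::binseq)"
  by (simp add: add.assoc)

lemma measurable_shift [measurable]: "(\<lambda>x::binseq. x + a) \<in> borel_measurable borel"
proof (rule borel_measurable_continuous_onI, rule continuous_on_coordinatewise_then_product)
  show "continuous_on UNIV (\<lambda>x::binseq. (x + a) i)" for i
  proof (subst continuous_on_open_vimage[OF open_UNIV], intro allI impI)
    fix S :: "bit set"
    have "(\<lambda>x. (x + a) i) -` S \<inter> UNIV = (\<lambda>x. x i) -` {b. b + a i \<in> S}"
      by (auto simp only: plus_fun_apply vimage_def)
    also have "open \<dots>"
      by (rule open_vimage[OF open_discrete continuous_on_product_coordinates])
    finally show "open ((\<lambda>x. (x + a) i) -` S \<inter> UNIV)" .
  qed
qed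

lemma coordinate_set_borel [measurable]: "{x::binseq. x n = b} \<in> sets borel"
proof -
  have "{x::binseq. x n = b} = (\<lambda>x. x n) -` {b}" by auto
  moreover have "open ((\<lambda>x::binseq. x n) -` {b})"
    by (rule open_vimage[OF open_discrete continuous_on_product_coordinates])
  ultimately show ?thesis by simp
qed

lemma measurable_completion_AE_cong:
  assumes f: "f \<in> measurable (completion M) N" and eq: "AE x in M. f x = g x" and g: "\<And>x. g x \<in> space N"
  shows "g \<in> measurable (completion M) N"
proof (rule measurableI)
  fix A assume A: "A \<in> sets N"
  have eq': "AE x in completion M. f x = g x" using eq by (rule AE_completion)
  show "g -` A \<inter> space (completion M) \<in> sets (completion M)"
    by (rule completion.in_sets_AE[OF _ measurable_sets[OF f A]]) (use eq' AE_space in eventually_elim, auto)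
qed (use g in auto)

text \<open>A version of the Radon-Nikodym derivative that is Borel, finite and nonnegative
  everywhere, so that it can be composed with translations without further null sets.\<close>

definition shift_density :: "binseq measure \<Rightarrow> binseq \<Rightarrow> (binseq \<Rightarrow> real) \<Rightarrow> bool" where
  "shift_density \<mu> a p \<longleftrightarrow> p \<in> borel_measurable borel \<and> (\<forall>x. 0 \<le> p x) \<and>
     translate a \<mu> = density \<mu> (\<lambda>x. ennreal (p x))"

locale binseq_measure = sigma_finite_measure \<mu> for \<mu> :: "binseq measure" +
  assumes sets_mu: "sets \<mu> = sets borel"
begin

lemma space_mu [simp]: "space \<mu> = UNIV"
  using sets_eq_imp_space_eq[OF sets_mu] by simp

lemma measurable_mu: "measurable \<mu> N = measurable borel N"
  by (rule measurable_cong_sets[OF sets_mu refl])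

lemma has_derivative_wrt_translate:
  "has_derivative_wrt (translate a \<mu>) \<mu> \<longleftrightarrow> (\<exists>p. shift_density \<mu> a p)"
  unfolding has_derivative_wrt_def shift_density_def by (auto simp: measurable_mu)

text \<open>Having a density, the translated measure charges no null set of \<open>\<mu>\<close>;
  hence almost everywhere statements may be evaluated at \<open>x + a\<close>.\<close>

lemma AE_shift:
  assumes "shift_density \<mu> a p" "AE x in \<mu>. P x"
  shows "AE x in \<mu>. P (x + a)"
proof -
  have p: "(\<lambda>x. ennreal (p x)) \<in> borel_measurable \<mu>"
    using assms(1) by (simp add: shift_density_def measurable_mu)
  have "AE x in density \<mu> (\<lambda>x. ennreal (p x)). P x"
    using assms(2) by (subst AE_density[OF p]) auto
  then have "AE x in distr \<mu> borel (\<lambda>x. x + a). P x"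
    using assms(1) unfolding shift_density_def translate_def by metis
  then show ?thesis
    by (rule AE_distrD[rotated]) (simp add: measurable_mu)
qed

text \<open>For the completion, Borel measurability of the translation does not suffice: preimages
  of null sets must be null as well, which is \<open>AE_shift\<close>.\<close>

lemma measurable_completion_shift:
  fixes g :: "binseq \<Rightarrow> 'b::{second_countable_topology, topological_space}"
  assumes sd: "shift_density \<mu> a p" and g: "g \<in> borel_measurable (completion \<mu>)"
  shows "(\<lambda>x. g (x + a)) \<in> borel_measurable (completion \<mu>)"
proof (rule measurable_compose[OF _ g])
  show "(\<lambda>x. x + a) \<in> completion \<mu> \<rightarrow>\<^sub>M completion \<mu>"
  proof (rule completion.measurable_completion2)
    show m: "(\<lambda>x. x + a) \<in> completion \<mu> \<rightarrow>\<^sub>M \<mu>"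
      by (rule measurable_completion) (simp add: measurable_mu measurable_cong_sets[OF refl sets_mu])
    show "null_sets \<mu> \<subseteq> null_sets (distr (completion \<mu>) \<mu> (\<lambda>x. x + a))"
    proof
      fix A assume A: "A \<in> null_sets \<mu>"
      have "AE x in \<mu>. x + a \<notin> A"
        by (rule AE_shift[OF sd AE_not_in[OF A]])
      then have "AE x in completion \<mu>. x + a \<notin> A" by (rule AE_completion)
      moreover have "(\<lambda>x. x + a) -` A \<inter> space (completion \<mu>) \<in> sets (completion \<mu>)"
        using A by (intro measurable_sets[OF m]) auto
      ultimately have "emeasure (completion \<mu>) ((\<lambda>x. x + a) -` A \<inter> space (completion \<mu>)) = 0"
        by (subst (asm) AE_iff_measurable[OF _ refl]) (auto simp: vimage_def Int_def)
      then show "A \<in> null_sets (distr (completion \<mu>) \<mu> (\<lambda>x. x + a))"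
        using A by (auto simp: null_sets_def emeasure_distr[OF m])
    qed
  qed
qed

lemma nn_integral_shift:
  assumes sd: "shift_density \<mu> a p" and g: "g \<in> borel_measurable (completion \<mu>)"
  shows "(\<integral>\<^sup>+x. ennreal (p x) * g (x + a) \<partial>\<mu>) = (\<integral>\<^sup>+x. g x \<partial>\<mu>)"
proof -
  \<comment> \<open>The transformation rules for densities and image measures need a Borel
    integrand, so \<open>g\<close> is replaced by a Borel version.\<close>
  obtain G where G: "G \<in> borel_measurable \<mu>" "AE x in \<mu>. g x = G x"
    using completion_ex_borel_measurable[OF g] by blast
  have [measurable]: "G \<in> borel_measurable borel" "p \<in> borel_measurable borel"
    using G(1) sd by (simp_all add: measurable_mu shift_density_def)
  have "(\<integral>\<^sup>+x. ennreal (p x) * g (x + a) \<partial>\<mu>) = (\<integral>\<^sup>+x. ennreal (p x) * G (x + a) \<partial>\<mu>)"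
    using AE_shift[OF sd G(2)] by (intro nn_integral_cong_AE) auto
  also have "\<dots> = (\<integral>\<^sup>+x. G (x + a) \<partial>density \<mu> (\<lambda>x. ennreal (p x)))"
    by (rule nn_integral_density[symmetric]) (simp_all add: measurable_mu)
  also have "\<dots> = (\<integral>\<^sup>+x. G (x + a) \<partial>distr \<mu> borel (\<lambda>x. x + a))"
    using sd by (simp add: shift_density_def translate_def)
  also have "\<dots> = (\<integral>\<^sup>+x. G (x + a + a) \<partial>\<mu>)"
    by (rule nn_integral_distr) (simp_all add: measurable_mu)
  also have "\<dots> = (\<integral>\<^sup>+x. g x \<partial>\<mu>)"
    using G(2) by (intro nn_integral_cong_AE) auto
  finally show ?thesis .
qed

text \<open>The cocycle identity of the derivatives. With uniqueness of densities, commutativity of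
  the group yields \<open>shift_density_commute\<close>, and \<open>a + a = 0\<close> yields
  \<open>shift_density_involution\<close>.\<close>

lemma shift_density_add:
  assumes p: "shift_density \<mu> a p" and q: "shift_density \<mu> b q"
  shows "shift_density \<mu> (a + b) (\<lambda>x. p (x + b) * q x)"
  unfolding shift_density_def
proof (intro conjI allI)
  have [measurable]: "p \<in> borel_measurable borel" "q \<in> borel_measurable borel"
    using p q by (simp_all add: shift_density_def)
  show "(\<lambda>x. p (x + b) * q x) \<in> borel_measurable borel" by measurable
  show "0 \<le> p (x + b) * q x" for x using p q by (simp add: shift_density_def)
  have "translate (a + b) \<mu> = distr (distr \<mu> borel (\<lambda>x. x + a)) borel (\<lambda>x. x + b)"
    unfolding translate_def by (subst distr_distr[OF measurable_shift]) (simp_all only: measurable_mu measurable_shift o_def add.assoc)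
  \<comment> \<open>Writing \<open>x\<close> as \<open>x + b + b\<close> exhibits the density as a
    function of \<open>x + b\<close>, so that it can be moved through the image measure.\<close>
  also have "\<dots> = distr (density \<mu> (\<lambda>x. ennreal (p (x + b + b)))) borel (\<lambda>x. x + b)"
    using p by (simp add: shift_density_def translate_def)
  also have "\<dots> = density (distr \<mu> borel (\<lambda>x. x + b)) (\<lambda>x. ennreal (p (x + b)))"
    using density_distr[of "\<lambda>x. ennreal (p (x + b))" borel "\<lambda>x. x + b" \<mu>, symmetric]
    by (simp only: measurable_mu measurable_shift) measurable
  also have "\<dots> = density (density \<mu> (\<lambda>x. ennreal (q x))) (\<lambda>x. ennreal (p (x + b)))"
    using q by (simp add: shift_density_def translate_def)
  also have "\<dots> = density \<mu> (\<lambda>x. ennreal (p (x + b) * q x))"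
    using p q by (subst density_density_eq) (auto simp: measurable_mu shift_density_def mult.commute ennreal_mult)
  finally show "translate (a + b) \<mu> = density \<mu> (\<lambda>x. ennreal (p (x + b) * q x))" .
qed

lemma shift_density_unique:
  assumes "shift_density \<mu> a p" "shift_density \<mu> a q"
  shows "AE x in \<mu>. p x = q x"
proof -
  have "AE x in \<mu>. ennreal (p x) = ennreal (q x)"
    using assms by (subst density_unique_iff[symmetric]) (auto simp: shift_density_def measurable_mu)
  then show ?thesis
    using assms by (auto simp: shift_density_def)
qed

lemma shift_density_commute:
  assumes "shift_density \<mu> a p" "shift_density \<mu> b q"
  shows "AE x in \<mu>. p (x + b) * q x = q (x + a) * p x"
  by (rule shift_density_unique[OF shift_density_add[OF assms]])
     (use shift_density_add[OF assms(2,1)] in \<open>simp add: add.commute\<close>)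

lemma shift_density_involution:
  assumes "shift_density \<mu> a p"
  shows "AE x in \<mu>. p (x + a) * p x = 1"
proof -
  have "translate 0 \<mu> = \<mu>"
    unfolding translate_def using distr_id2[OF sets_mu[symmetric]] by (simp add: id_def)
  then have "shift_density \<mu> 0 (\<lambda>_. 1)" by (simp add: shift_density_def density_1)
  with shift_density_add[OF assms assms] show ?thesis
    by (intro shift_density_unique) simp_all
qed

lemma shift_density_pos:
  assumes "shift_density \<mu> a p"
  shows "AE x in \<mu>. 0 < p x"
  using shift_density_involution[OF assms]
proof eventually_elim
  case (elim x)
  then have "p x \<noteq> 0" by auto
  with assms show ?case by (simp add: shift_density_def less_le)
qed

text \<open>The Radon-Nikodym theorem. The derivative is finite almost everywhere because the
  translated measure is again \<sigma>-finite, and \<open>enn2real\<close> makes it finite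
  everywhere.\<close>

lemma shift_density_exI:
  assumes null: "\<And>A. A \<in> null_sets \<mu> \<Longrightarrow> (\<lambda>x. x + a) -` A \<in> null_sets \<mu>"
  shows "\<exists>p. shift_density \<mu> a p"
proof -
  have sets_tr: "sets (translate a \<mu>) = sets \<mu>" by (simp add: translate_def sets_mu)
  have ac: "absolutely_continuous \<mu> (translate a \<mu>)"
    unfolding absolutely_continuous_def
  proof
    fix A assume A: "A \<in> null_sets \<mu>"
    then have "A \<in> sets borel" by (auto simp: sets_mu)
    with null[OF A] show "A \<in> null_sets (translate a \<mu>)"
      by (auto simp: null_sets_def translate_def emeasure_distr measurable_mu)
  qed
  \<comment> \<open>Translating once more recovers \<open>\<mu>\<close>, so a \<sigma>-finite
    exhaustion can be pulled back.\<close>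
  interpret tr: sigma_finite_measure "translate a \<mu>"
  proof (rule sigma_finite_measure_distr)
    show m: "(\<lambda>x. x + a) \<in> translate a \<mu> \<rightarrow>\<^sub>M \<mu>"
      by (simp add: measurable_cong_sets[OF sets_tr refl] measurable_mu measurable_cong_sets[OF refl sets_mu])
    have "distr (translate a \<mu>) \<mu> (\<lambda>x. x + a) = distr \<mu> \<mu> (\<lambda>x. x)"
      unfolding translate_def
      by (subst distr_distr) (auto simp: measurable_mu o_def measurable_cong_sets[OF refl sets_mu])
    then show "sigma_finite_measure (distr (translate a \<mu>) \<mu> (\<lambda>x. x + a))"
      by (simp add: distr_id2[OF refl] sigma_finite_measure_axioms)
  qed
  let ?f = "RN_deriv \<mu> (translate a \<mu>)"
  have fin: "AE x in \<mu>. ?f x \<noteq> \<infinity>"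
    by (rule RN_deriv_finite[OF tr.sigma_finite_measure_axioms ac sets_tr])
  have "translate a \<mu> = density \<mu> ?f" by (rule density_RN_deriv[OF ac sets_tr, symmetric])
  also have "\<dots> = density \<mu> (\<lambda>x. ennreal (enn2real (?f x)))"
    using fin by (intro density_cong) (auto simp: less_top)
  finally show ?thesis
    using borel_measurable_RN_deriv[of \<mu> "translate a \<mu>"]
    by (intro exI[of _ "\<lambda>x. enn2real (?f x)"]) (auto simp: shift_density_def measurable_mu)
qed

end

subsection \<open>Measurable sections\<close>

lemma bounded_linear_scaleC_left: "bounded_linear (\<lambda>a. a *\<^sub>C (v::'h::complex_hilbert_space))"
proof (rule bounded_linear_intro[where K = "norm v"])
  show "(r *\<^sub>R a) *\<^sub>C v = r *\<^sub>R (a *\<^sub>C v)" for r a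
    unfolding scaleC_of_real[symmetric] scaleC_scaleC by (simp add: scaleR_conv_of_real)
qed (simp_all add: scaleC_add_left norm_scaleC)

text \<open>Lists over a countable dense set of scalars form one countable index set that yields a
  dense subset of every fibre at once.\<close>

definition list_comb :: "(nat \<Rightarrow> 'h::complex_hilbert_space) \<Rightarrow> complex list \<Rightarrow> 'h" where
  "list_comb u q = (\<Sum>i<length q. (q ! i) *\<^sub>C u i)"

lemma closure_span_subset_closure_list_comb:
  assumes D: "closure D = UNIV"
  shows "closure (complex_vector.span (range u)) \<subseteq> closure (list_comb u ` lists D)"
proof (rule closure_minimal)
  show "complex_vector.span (range u) \<subseteq> closure (list_comb u ` lists D)"
  proof
    fix v assume "v \<in> complex_vector.span (range u)"
    then obtain N a where v: "v = (\<Sum>i<N. a i *\<^sub>C u i)" by (rule span_range_finite_sum)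
    have "\<exists>d. (\<forall>n. d n \<in> D) \<and> d \<longlonglongrightarrow> z" for z
      using D closure_sequential[of z D] by simp
    then obtain d where d: "\<And>z n. d z n \<in> D" "\<And>z. d z \<longlonglongrightarrow> z" by metis
    have comb: "list_comb u (map (\<lambda>i. d (a i) n) [0..<N]) = (\<Sum>i<N. d (a i) n *\<^sub>C u i)" for n
      by (simp add: list_comb_def)
    have "(\<lambda>n. list_comb u (map (\<lambda>i. d (a i) n) [0..<N])) \<longlonglongrightarrow> v"
      unfolding comb v
      by (intro tendsto_sum bounded_linear.tendsto[OF bounded_linear_scaleC_left] d)
    moreover have "list_comb u (map (\<lambda>i. d (a i) n) [0..<N]) \<in> list_comb u ` lists D" for n
      using d by (intro imageI) auto
    ultimately show "v \<in> closure (list_comb u ` lists D)"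
      unfolding closure_sequential
      by (intro exI[of _ "\<lambda>n. list_comb u (map (\<lambda>i. d (a i) n) [0..<N])"]) blast
  qed
qed simp

text \<open>The norm as a supremum over a countable dense set. For the converse, \<open>v\<close>
  itself is approximated by combinations, giving \<open>norm v * norm v \<le> t * norm v\<close> in
  the limit.\<close>

lemma norm_le_iff_list_comb:
  assumes D: "closure D = UNIV" and v: "v \<in> closure (complex_vector.span (range u))" and t: "0 \<le> t"
  shows "norm v \<le> t \<longleftrightarrow> (\<forall>q\<in>lists D. cmod (cinner (list_comb u q) v) \<le> t * norm (list_comb u q))"
proof
  assume "norm v \<le> t"
  then have "norm (list_comb u q) * norm v \<le> t * norm (list_comb u q)" for q
    by (subst mult.commute) (rule mult_right_mono, simp_all)
  then show "\<forall>q\<in>lists D. cmod (cinner (list_comb u q) v) \<le> t * norm (list_comb u q)"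
    using cinner_bound order_trans by blast
next
  assume *: "\<forall>q\<in>lists D. cmod (cinner (list_comb u q) v) \<le> t * norm (list_comb u q)"
  have "v \<in> closure (list_comb u ` lists D)"
    using closure_span_subset_closure_list_comb[OF D] v by blast
  then obtain p where p: "\<And>n. p n \<in> list_comb u ` lists D" "p \<longlonglongrightarrow> v"
    unfolding closure_sequential by metis
  have "cmod (cinner v v) \<le> t * norm v"
  proof (rule LIMSEQ_le)
    show "(\<lambda>n. cmod (cinner (p n) v)) \<longlonglongrightarrow> cmod (cinner v v)"
      by (intro tendsto_norm tendsto_cinner_left p)
    show "(\<lambda>n. t * norm (p n)) \<longlonglongrightarrow> t * norm v"
      by (intro tendsto_intros p)
    show "\<exists>N. \<forall>n\<ge>N. cmod (cinner (p n) v) \<le> t * norm (p n)"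
      using * p(1) by (metis imageE)
  qed
  then have "norm v * norm v \<le> t * norm v"
    unfolding cinner_self by (simp add: norm_mult power2_eq_square)
  then show "norm v \<le> t"
    using t mult_right_le_imp_le[of "norm v" "norm v" t] by fastforce
qed

locale section_space = binseq_measure \<mu> for \<mu> :: "binseq measure" +
  fixes V :: "binseq \<Rightarrow> 'h::complex_hilbert_space set" and e :: "nat \<Rightarrow> binseq \<Rightarrow> 'h"
  assumes family: "measurable_family \<mu> V e"
begin

abbreviation "M \<equiv> completion \<mu>"
abbreviation "msec \<equiv> msections \<mu> V e"
abbreviation "L2 \<equiv> L2_sections \<mu> V e"

lemma V_eq: "V x = closure (complex_vector.span (range (\<lambda>n. e n x)))"
  using family by (simp add: measurable_family_def)

lemma subspace_V: "complex_vector.subspace (V x)"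
  using family by (simp add: measurable_family_def hilbert_subspace_def)

lemma V_closed_arith:
  "0 \<in> V x" "u \<in> V x \<Longrightarrow> v \<in> V x \<Longrightarrow> u + v \<in> V x" "u \<in> V x \<Longrightarrow> a *\<^sub>C u \<in> V x"
  "u \<in> V x \<Longrightarrow> t *\<^sub>R u \<in> V x"
  using subspace_V[of x] by (auto simp: complex_vector.subspace_def simp flip: scaleC_of_real)

lemma e_in_V: "e n x \<in> V x"
  unfolding V_eq by (auto intro!: subsetD[OF closure_subset] complex_vector.span_base)

lemma e_msec: "e n \<in> msec"
  using family by (simp add: msections_def measurable_family_def e_in_V)

lemma msec_in_V: "f \<in> msec \<Longrightarrow> AE x in \<mu>. f x \<in> V x"
  by (simp add: msections_def)

lemma msec_e_measurable: "f \<in> msec \<Longrightarrow> (\<lambda>x. cinner (e n x) (f x)) \<in> borel_measurable M"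
  by (simp add: msections_def)

text \<open>Measurability of a section is only tested against the \<open>e n\<close>. A bound on the
  norm amounts to countably many inequalities, whose two sides are built from the inner products of
  the \<open>e n\<close> with each other and with \<open>f\<close>.\<close>

lemma msec_norm [measurable]:
  assumes f: "f \<in> msec"
  shows "(\<lambda>x. norm (f x)) \<in> borel_measurable M"
proof (rule borel_measurableI_le)
  fix t :: real
  obtain D :: "complex set" where "countable D" and D: "\<And>X. open X \<Longrightarrow> X \<noteq> {} \<Longrightarrow> \<exists>d\<in>D. d \<in> X"
    using countable_dense_setE by metis
  have cl: "closure D = UNIV"
    using D[of "- closure D"] closure_subset[of D] by auto
  have cnt: "countable (lists D)" using \<open>countable D\<close> by simp
  have [measurable]: "(\<lambda>x. cinner (e m x) (e n x)) \<in> borel_measurable M" for m n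
    using family by (simp add: measurable_family_def)
  have [measurable]: "(\<lambda>x. cinner (e n x) (f x)) \<in> borel_measurable M" for n
    by (rule msec_e_measurable[OF f])
  let ?d = "\<lambda>q x. list_comb (\<lambda>i. e i x) q"
  have nrm: "norm (?d q x) = sqrt (Re (\<Sum>i<length q. \<Sum>j<length q. (q ! i) * (cnj (q ! j) * cinner (e j x) (e i x))))" for q x
  proof -
    have "(\<Sum>i<length q. \<Sum>j<length q. (q ! i) * (cnj (q ! j) * cinner (e j x) (e i x))) = cinner (?d q x) (?d q x)"
      by (simp add: list_comb_def cinner_sum_left cinner_sum_right cinner_scaleC_left cinner_scaleC_right sum_distrib_left)
    then show ?thesis by (simp add: cinner_self)
  qed
  have inn: "cinner (?d q x) (f x) = (\<Sum>i<length q. cnj (q ! i) * cinner (e i x) (f x))" for q x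
    by (simp add: list_comb_def cinner_sum_left cinner_scaleC_left)
  have [measurable]: "(\<lambda>x. norm (?d q x)) \<in> borel_measurable M" for q
    unfolding nrm by measurable
  have [measurable]: "(\<lambda>x. cinner (?d q x) (f x)) \<in> borel_measurable M" for q
    unfolding inn by measurable
  show "{x \<in> space M. norm (f x) \<le> t} \<in> sets M"
  proof (cases "0 \<le> t")
    case True
    show ?thesis
    \<comment> \<open>The criterion requires \<open>f x \<in> V x\<close>, known only almost
      everywhere; the completed \<sigma>-algebra absorbs the difference.\<close>
    proof (rule completion.in_sets_AE)
      show "{x \<in> space M. \<forall>q\<in>lists D. cmod (cinner (?d q x) (f x)) \<le> t * norm (?d q x)} \<in> sets M"
      proof -
        have meas: "{x \<in> space M. cmod (cinner (?d q x) (f x)) \<le> t * norm (?d q x)} \<in> sets M" for q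
          by measurable
        have "{x \<in> space M. \<forall>q\<in>lists D. cmod (cinner (?d q x) (f x)) \<le> t * norm (?d q x)}
          = (\<Inter>q\<in>lists D. {x \<in> space M. cmod (cinner (?d q x) (f x)) \<le> t * norm (?d q x)})"
          by auto
        also have "\<dots> \<in> sets M"
          by (intro sets.countable_INT' cnt image_subsetI meas) (auto intro: lists.Nil)
        finally show ?thesis .
      qed
      have "AE x in M. f x \<in> V x" by (rule AE_completion[OF msec_in_V[OF f]])
      then show "AE x in M. (x \<in> {x \<in> space M. \<forall>q\<in>lists D. cmod (cinner (?d q x) (f x)) \<le> t * norm (?d q x)})
          = (x \<in> {x \<in> space M. norm (f x) \<le> t})"
        using AE_space
        by eventually_elim (simp add: V_eq norm_le_iff_list_comb[OF cl _ True])
    qed auto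
  next
    case False
    then have "{x \<in> space M. norm (f x) \<le> t} = {}"
      using norm_ge_zero order_trans by blast
    then show ?thesis by simp
  qed
qed

lemma msec_add: "f \<in> msec \<Longrightarrow> g \<in> msec \<Longrightarrow> (\<lambda>x. f x + g x) \<in> msec"
  unfolding msections_def by (auto simp: cinner_add_right elim: eventually_elim2 intro!: borel_measurable_add V_closed_arith)

lemma msec_scaleC: "f \<in> msec \<Longrightarrow> a \<in> borel_measurable M \<Longrightarrow> (\<lambda>x. a x *\<^sub>C f x) \<in> msec"
  unfolding msections_def by (auto simp: cinner_scaleC_right elim: eventually_mono intro!: borel_measurable_times V_closed_arith)

lemma msec_scaleR:
  assumes "f \<in> msec" "a \<in> borel_measurable M"
  shows "(\<lambda>x. a x *\<^sub>R f x) \<in> msec"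
  using msec_scaleC[OF assms(1), of "\<lambda>x. complex_of_real (a x)"] assms(2) by (simp add: scaleC_of_real)

lemma msec_cinner [measurable]:
  assumes f: "f \<in> msec" and g: "g \<in> msec"
  shows "(\<lambda>x. cinner (f x) (g x)) \<in> borel_measurable M"
proof -
  note [measurable] = f g
  have [measurable]: "(\<lambda>x. f x + g x) \<in> msec" "(\<lambda>x. \<i> *\<^sub>C f x + g x) \<in> msec"
    by (intro msec_add msec_scaleC f g; simp)+
  show ?thesis
    unfolding cinner_norm_polarization Complex_eq by measurable
qed

lemma L2_iff: "f \<in> L2 \<longleftrightarrow> f \<in> msec \<and> (\<integral>\<^sup>+x. ennreal ((norm (f x))\<^sup>2) \<partial>\<mu>) < \<infinity>"
proof (cases "f \<in> msec")
  case True
  note [measurable] = True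
  have "(\<lambda>x. (norm (f x))\<^sup>2) \<in> borel_measurable M" by measurable
  then show ?thesis
    using True by (simp add: L2_sections_def integrable_iff_bounded nn_integral_completion)
qed (simp add: L2_sections_def)

lemma L2_msec: "f \<in> L2 \<Longrightarrow> f \<in> msec"
  by (simp add: L2_iff)

lemma L2_norm_eq:
  assumes "f \<in> msec"
  shows "L2_norm \<mu> f = sqrt (enn2real (\<integral>\<^sup>+x. ennreal ((norm (f x))\<^sup>2) \<partial>\<mu>))"
proof -
  note [measurable] = assms
  show ?thesis unfolding L2_norm_def
    by (subst integral_eq_nn_integral) (simp_all add: nn_integral_completion)
qed

lemma L2_bounded_multiple:
  assumes f: "f \<in> L2" and a: "a \<in> borel_measurable M" and bd: "\<And>x. cmod (a x) \<le> 1"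
  shows "(\<lambda>x. a x *\<^sub>C f x) \<in> L2"
proof -
  have "(\<integral>\<^sup>+x. ennreal ((norm (a x *\<^sub>C f x))\<^sup>2) \<partial>\<mu>) \<le> (\<integral>\<^sup>+x. ennreal ((norm (f x))\<^sup>2) \<partial>\<mu>)"
    using bd by (intro nn_integral_mono ennreal_leI power_mono) (simp_all add: norm_scaleC mult_left_le_one_le)
  then show ?thesis using f msec_scaleC[OF L2_msec[OF f] a] by (simp add: L2_iff order_le_less_trans)
qed

lemma L2_combination:
  assumes f: "f \<in> L2" and g: "g \<in> L2"
  shows "(\<lambda>x. a *\<^sub>C f x + b *\<^sub>C g x) \<in> L2"
proof -
  note [measurable] = L2_msec[OF f] L2_msec[OF g]
  have bd: "(norm (a *\<^sub>C f x + b *\<^sub>C g x))\<^sup>2 \<le> 2 * (cmod a)\<^sup>2 * (norm (f x))\<^sup>2 + 2 * (cmod b)\<^sup>2 * (norm (g x))\<^sup>2" for x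
  proof -
    have "(norm (a *\<^sub>C f x + b *\<^sub>C g x))\<^sup>2 \<le> (cmod a * norm (f x) + cmod b * norm (g x))\<^sup>2"
      by (intro power_mono norm_ge_zero order_trans[OF norm_triangle_ineq]) (simp add: norm_scaleC)
    also have "\<dots> \<le> 2 * (cmod a * norm (f x))\<^sup>2 + 2 * (cmod b * norm (g x))\<^sup>2"
      using sum_squares_bound[of "cmod a * norm (f x)" "cmod b * norm (g x)"] by (simp add: power2_sum)
    finally show ?thesis by (simp add: power_mult_distrib mult.assoc)
  qed
  have "(\<integral>\<^sup>+x. ennreal ((norm (a *\<^sub>C f x + b *\<^sub>C g x))\<^sup>2) \<partial>\<mu>)
      \<le> (\<integral>\<^sup>+x. ennreal (2 * (cmod a)\<^sup>2) * ennreal ((norm (f x))\<^sup>2) + ennreal (2 * (cmod b)\<^sup>2) * ennreal ((norm (g x))\<^sup>2) \<partial>M)"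
    unfolding nn_integral_completion
    using bd by (intro nn_integral_mono) (simp flip: ennreal_mult ennreal_plus add: ennreal_leI)
  also have "\<dots> = ennreal (2 * (cmod a)\<^sup>2) * (\<integral>\<^sup>+x. ennreal ((norm (f x))\<^sup>2) \<partial>M)
      + ennreal (2 * (cmod b)\<^sup>2) * (\<integral>\<^sup>+x. ennreal ((norm (g x))\<^sup>2) \<partial>M)"
    by (subst nn_integral_add, measurable) (subst nn_integral_cmult, measurable)+
  also have "\<dots> < \<infinity>"
    using f g by (simp add: L2_iff nn_integral_completion ennreal_mult_less_top)
  finally show ?thesis
    using msec_add[OF msec_scaleC[OF L2_msec[OF f], of "\<lambda>_. a"] msec_scaleC[OF L2_msec[OF g], of "\<lambda>_. b"]]
    by (simp add: L2_iff)
qed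

text \<open>The \<open>e n\<close> need not be square integrable. By \<sigma>-finiteness there is a
  strictly positive integrable \<open>h\<close>, and the weights are chosen so that the square of
  the rescaled norm is at most \<open>h\<close>. Their positivity preserves the spans.\<close>

lemma fundamental_L2:
  obtains w :: "nat \<Rightarrow> binseq \<Rightarrow> real" where "\<And>n. w n \<in> borel_measurable M" "\<And>n x. 0 < w n x"
    "\<And>n. (\<lambda>x. w n x *\<^sub>R e n x) \<in> L2"
proof -
  obtain h where h: "h \<in> borel_measurable \<mu>" "integral\<^sup>N \<mu> h \<noteq> \<infinity>" "\<And>x. 0 < h x \<and> h x < \<infinity>"
    using Ex_finite_integrable_function by auto
  note [measurable] = measurable_completion[OF h(1)] e_msec
  \<comment> \<open>The summand 1 keeps the denominator positive where \<open>e n\<close>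
    vanishes.\<close>
  define w where "w n x = sqrt (enn2real (h x)) / (1 + norm (e n x))" for n x
  have pos: "0 < enn2real (h x)" for x
    using h(3)[of x] by (simp add: enn2real_positive_iff)
  show thesis
  proof (rule that[of w])
    show w: "w n \<in> borel_measurable M" for n unfolding w_def by measurable
    show "0 < w n x" for n x
      using pos[of x] norm_ge_zero[of "e n x"] by (auto simp: w_def intro!: divide_pos_pos add_pos_nonneg)
    show "(\<lambda>x. w n x *\<^sub>R e n x) \<in> L2" for n
    proof -
      have "(norm (w n x *\<^sub>R e n x))\<^sup>2 \<le> enn2real (h x)" for x
      proof -
        have "norm (w n x *\<^sub>R e n x) \<le> sqrt (enn2real (h x))"
          using pos[of x] norm_ge_zero[of "e n x"] unfolding w_def norm_scaleR
          by (simp add: pos_divide_le_eq add_pos_nonneg distrib_left)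
        from power_mono[OF this, of 2] show ?thesis by simp
      qed
      then have "(\<integral>\<^sup>+x. ennreal ((norm (w n x *\<^sub>R e n x))\<^sup>2) \<partial>\<mu>) \<le> (\<integral>\<^sup>+x. ennreal (enn2real (h x)) \<partial>\<mu>)"
        by (intro nn_integral_mono ennreal_leI)
      also have "\<dots> = integral\<^sup>N \<mu> h"
        using h(3) by (intro nn_integral_cong) simp
      also have "\<dots> < \<infinity>" using h(2) by (simp add: less_top)
      finally show ?thesis
        using msec_scaleR[OF e_msec w] by (simp add: L2_iff)
    qed
  qed
qed

end

subsection \<open>The operators of a Garding--Wightman triple\<close>

lemma delta_in_Delta: "delta k \<in> Delta"
proof -
  have "{n. delta k n = 1} \<subseteq> {..k}" by (auto simp: delta_def split: if_splits)
  then show ?thesis unfolding Delta_def using finite_subset by blast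
qed

lemma parity_sign_Suc: "parity_sign (Suc j) x = parity_sign j x * (if x j = 1 then -1 else 1)"
  by (simp add: parity_sign_def)

lemma cmod_parity_sign: "cmod (parity_sign m x) = 1"
  by (simp add: parity_sign_def norm_power)

lemma cnj_parity_sign: "cnj (parity_sign m x) = parity_sign m x"
  by (simp add: parity_sign_def)

lemma parity_sign_square: "parity_sign m x * parity_sign m x = 1"
  by (simp add: parity_sign_def flip: power_mult_distrib)

text \<open>Positions start at 1: \<open>delta (Suc j)\<close> flips coordinate \<open>j\<close>,
  the first one that \<open>parity_sign j\<close> does not count.\<close>

lemma parity_sign_delta: "parity_sign j (x + delta (Suc j)) = parity_sign j x"
  unfolding parity_sign_def by (intro arg_cong[where f = "power (-1)"] sum.cong) (simp_all add: delta_def)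

lemma parity_sign_check: "parity_sign m (check x) = (-1) ^ m * parity_sign m x"
proof (induction m)
  case 0
  show ?case by (simp add: parity_sign_def)
next
  case (Suc m)
  have "(if check x m = 1 then -1 else 1) = (- (if x m = 1 then -1 else 1) :: complex)"
    by (cases "x m") simp_all
  with Suc show ?case by (simp only: parity_sign_Suc power_Suc) simp
qed

lemma parity_sign_measurable [measurable]: "parity_sign m \<in> borel_measurable borel"
proof (induction m)
  case 0
  show ?case by (simp add: parity_sign_def)
next
  case (Suc m)
  have "parity_sign (Suc m) = (\<lambda>x. parity_sign m x * (if x \<in> {x. x m = 1} then -1 else 1))"
    by (rule ext) (simp add: parity_sign_Suc)
  with Suc show ?case by simp
qed

lemma unitary_betweenD:
  assumes "unitary_between W W' T" "u \<in> W"
  shows "T u \<in> W'" "T (a *\<^sub>C u) = a *\<^sub>C T u" "norm (T u) = norm u"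
    "v \<in> W \<Longrightarrow> cinner (T u) (T v) = cinner u v"
proof -
  have lin: "T (a *\<^sub>C u + b *\<^sub>C v) = a *\<^sub>C T u + b *\<^sub>C T v" if "v \<in> W" for v a b
    using assms that by (simp add: unitary_between_def)
  have inn: "cinner (T u) (T v) = cinner u v" if "v \<in> W" for v
    using assms that by (simp add: unitary_between_def)
  show "T u \<in> W'" using assms by (auto simp: unitary_between_def)
  show "T (a *\<^sub>C u) = a *\<^sub>C T u" using lin[OF assms(2), of a 0] by simp
  show "norm (T u) = norm u"
    using inn[OF assms(2)] unfolding cinner_self of_real_eq_iff by (metis norm_ge_zero power2_eq_iff_nonneg)
  show "cinner (T u) (T v) = cinner u v" if "v \<in> W" by (rule inn[OF that])
qed

locale gw_triple =
  fixes \<mu> :: "binseq measure"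
    and V :: "binseq \<Rightarrow> 'h::complex_hilbert_space set"
    and e :: "nat \<Rightarrow> binseq \<Rightarrow> 'h"
    and c :: "nat \<Rightarrow> binseq \<Rightarrow> 'h \<Rightarrow> 'h"
  assumes gw: "GW_triple \<mu> V e c"

sublocale gw_triple \<subseteq> section_space \<mu> V e
  using gw unfolding GW_triple_def
  by (intro section_space.intro binseq_measure.intro section_space_axioms.intro binseq_measure_axioms.intro) simp_all

context gw_triple
begin

abbreviation "s \<equiv> sqrt_deriv \<mu>"

lemma borel_completion: "f \<in> borel_measurable borel \<Longrightarrow> f \<in> borel_measurable M"
  by (rule measurable_completion) (simp add: measurable_mu)

lemma s_measurable [measurable]: "s k \<in> borel_measurable borel"
  using borel_measurable_RN_deriv[of \<mu> "translate (delta k) \<mu>"]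
  unfolding sqrt_deriv_def by (simp add: measurable_mu)

lemma s_nonneg: "0 \<le> s k x"
  by (simp add: sqrt_deriv_def)

text \<open>\<open>sqrt_deriv\<close> is taken from the extended real \<open>RN_deriv\<close>.
  Quasi-invariance supplies a finite density that agrees with it almost everywhere, so the square is
  a density too.\<close>

lemma s_density: "shift_density \<mu> (delta k) (\<lambda>x. (s k x)\<^sup>2)"
proof -
  have "has_derivative_wrt (translate (delta k) \<mu>) \<mu>"
    using gw delta_in_Delta unfolding GW_triple_def equivalent_measures_def by blast
  then obtain p where p: "shift_density \<mu> (delta k) p"
    unfolding has_derivative_wrt_translate by blast
  then have pm: "(\<lambda>x. ennreal (p x)) \<in> borel_measurable \<mu>" and p0: "\<And>x. 0 \<le> p x"
    and tr: "translate (delta k) \<mu> = density \<mu> (\<lambda>x. ennreal (p x))"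
    by (simp_all add: shift_density_def measurable_mu)
  have "AE x in \<mu>. ennreal (p x) = RN_deriv \<mu> (translate (delta k) \<mu>) x"
    by (rule RN_deriv_unique[OF pm]) (simp add: tr)
  then have eq: "AE x in \<mu>. ennreal (p x) = ennreal ((s k x)\<^sup>2)"
  proof eventually_elim
    case (elim x)
    then have "enn2real (RN_deriv \<mu> (translate (delta k) \<mu>) x) = p x" by (metis enn2real_ennreal p0)
    then show ?case by (simp add: sqrt_deriv_def p0)
  qed
  have "density \<mu> (\<lambda>x. ennreal (p x)) = density \<mu> (\<lambda>x. ennreal ((s k x)\<^sup>2))"
    using eq pm by (intro density_cong) (simp_all add: measurable_mu)
  then show ?thesis by (simp add: shift_density_def tr)
qed

lemma s_pos: "AE x in \<mu>. 0 < s k x"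
  using shift_density_pos[OF s_density[of k]]
  by eventually_elim (simp add: s_nonneg less_le)

lemma s_involution: "AE x in \<mu>. s k x * s k (x + delta k) = 1"
  using shift_density_involution[OF s_density[of k]]
proof eventually_elim
  case (elim x)
  then have "(s k x * s k (x + delta k))\<^sup>2 = 1\<^sup>2" by (simp add: power_mult_distrib mult.commute)
  then show ?case by (rule power2_eq_imp_eq) (simp_all add: s_nonneg)
qed

lemmas AE_delta = AE_shift[OF s_density]

lemma V_delta: "AE x in \<mu>. V (x + delta k) = V x"
  using gw delta_in_Delta unfolding GW_triple_def by blast

lemma msec_delta: "f \<in> msec \<Longrightarrow> (\<lambda>x. f (x + delta k)) \<in> msec"
  using gw delta_in_Delta unfolding GW_triple_def by blast

lemma msec_c: "1 \<le> k \<Longrightarrow> f \<in> msec \<Longrightarrow> (\<lambda>x. c k x (f x)) \<in> msec"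
  using gw unfolding GW_triple_def by blast

lemma c_unitary:
  assumes "1 \<le> k"
  shows "AE x in \<mu>. unitary_between (V x) (V x) (c k x)"
proof -
  have "AE x in \<mu>. unitary_between (V x) (V (x + delta k)) (c k x)"
    using gw assms unfolding GW_triple_def by blast
  then show ?thesis
    using V_delta[of k] by eventually_elim simp
qed

text \<open>\<open>c k (x + delta k)\<close> is the adjoint, hence the inverse, of the unitary
  \<open>c k x\<close>. Surjectivity lets every test vector be written as
  \<open>c k x u\<close>.\<close>

lemma c_involution:
  assumes k: "1 \<le> k"
  shows "AE x in \<mu>. \<forall>v\<in>V x. c k x (c k (x + delta k) v) = v"
proof -
  have "AE x in \<mu>. \<forall>u\<in>V x. \<forall>v\<in>V x. cinner (c k x u) v = cinner u (c k (x + delta k) v)"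
    using gw k unfolding GW_triple_def by blast
  then show ?thesis
    using c_unitary[OF k] AE_delta[OF c_unitary[OF k], of k] V_delta[of k]
  proof eventually_elim
    case (elim x)
    have sa: "cinner (c k x u) v = cinner u (c k (x + delta k) v)" if "u \<in> V x" "v \<in> V x" for u v
      using elim(1) that by blast
    show ?case
    proof
      fix v assume v: "v \<in> V x"
      have cv: "c k (x + delta k) v \<in> V x"
        using unitary_betweenD(1)[OF elim(3)] elim(4) v by simp
      have ccv: "c k x (c k (x + delta k) v) \<in> V x"
        by (rule unitary_betweenD(1)[OF elim(2) cv])
      have "cinner w (c k x (c k (x + delta k) v)) = cinner w v" if w: "w \<in> V x" for w
      proof -
        have "c k x ` V x = V x" using elim(2) by (simp add: unitary_between_def)
        then obtain u where u: "u \<in> V x" "w = c k x u" using w by (metis imageE)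
        show ?thesis
          by (simp only: u(2) unitary_betweenD(4)[OF elim(2) u(1) cv] sa[OF u(1) v])
      qed
      then have "cinner (e n x) (c k x (c k (x + delta k) v)) = cinner (e n x) v" for n
        using e_in_V by blast
      then show "c k x (c k (x + delta k) v) = v"
        using v ccv unfolding V_eq by (intro closure_span_eqI[of _ "range (\<lambda>n. e n x)"]) auto
    qed
  qed
qed

text \<open>The common form of \<open>J\<close> and \<open>J'\<close>. As \<open>c k x\<close> is
  isometric and the square of \<open>s k\<close> is the density of the translation, only the bounded
  factor \<open>a\<close> can change the norm.\<close>

lemma twisted_shift_L2:
  assumes k: "1 \<le> k" and f: "f \<in> L2" and a: "a \<in> borel_measurable borel" "\<And>x. cmod (a x) \<le> 1"
  shows "(\<lambda>x. a x *\<^sub>C c k x (s k x *\<^sub>R f (x + delta k))) \<in> L2"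
proof (rule L2_bounded_multiple)
  note [measurable] = L2_msec[OF f]
  have "(\<integral>\<^sup>+x. ennreal ((norm (c k x (s k x *\<^sub>R f (x + delta k))))\<^sup>2) \<partial>\<mu>)
      = (\<integral>\<^sup>+x. ennreal ((s k x)\<^sup>2) * ennreal ((norm (f (x + delta k)))\<^sup>2) \<partial>\<mu>)"
  proof (rule nn_integral_cong_AE)
    show "AE x in \<mu>. ennreal ((norm (c k x (s k x *\<^sub>R f (x + delta k))))\<^sup>2)
        = ennreal ((s k x)\<^sup>2) * ennreal ((norm (f (x + delta k)))\<^sup>2)"
      using c_unitary[OF k] V_delta[of k] AE_delta[OF msec_in_V[OF L2_msec[OF f]], of k]
      by eventually_elim
        (simp add: unitary_betweenD(3)[of "V _" "V _"] V_closed_arith power_mult_distrib ennreal_mult)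
  qed
  also have "\<dots> = (\<integral>\<^sup>+x. ennreal ((norm (f x))\<^sup>2) \<partial>\<mu>)"
    by (rule nn_integral_shift[OF s_density]) measurable
  also have "\<dots> < \<infinity>" using f by (simp add: L2_iff)
  finally show "(\<lambda>x. c k x (s k x *\<^sub>R f (x + delta k))) \<in> L2"
    using msec_c[OF k msec_scaleR[OF msec_delta[OF L2_msec[OF f]]], of "s k"]
    by (simp add: L2_iff borel_completion)
qed (use a borel_completion in auto)

lemma J_L2: "1 \<le> k \<Longrightarrow> f \<in> L2 \<Longrightarrow> J \<mu> c k f \<in> L2"
  unfolding J_def by (rule twisted_shift_L2) (simp_all add: norm_mult cmod_parity_sign)

lemma J'_L2: "1 \<le> k \<Longrightarrow> f \<in> L2 \<Longrightarrow> J' \<mu> c k f \<in> L2"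
  unfolding J'_def by (rule twisted_shift_L2) (simp_all add: cmod_parity_sign)

lemma J_cong:
  assumes "AE x in \<mu>. f x = g x"
  shows "AE x in \<mu>. J \<mu> c k f x = J \<mu> c k g x"
  using AE_delta[OF assms, of k] by eventually_elim (simp add: J_def)

text \<open>Translations, operators \<open>c\<close> and derivatives cancel in pairs, so only
  scalars survive; the sign of \<open>J'\<close> is evaluated after flipping coordinate
  \<open>j\<close>, which contributes the sign of that coordinate. Thus Clifford elements act as
  multiplication by coordinate functions.\<close>

lemma J_J':
  assumes f: "f \<in> L2"
  shows "AE x in \<mu>. J \<mu> c (Suc j) (J' \<mu> c (Suc j) f) x = (\<i> * (if x j = 1 then -1 else 1)) *\<^sub>C f x"
proof -
  have k: "1 \<le> Suc j" by simp
  show ?thesis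
    using c_unitary[OF k] AE_delta[OF c_unitary[OF k], of "Suc j"] c_involution[OF k] V_delta[of "Suc j"] s_involution[of "Suc j"]
      msec_in_V[OF L2_msec[OF f]]
  proof eventually_elim
    case (elim x)
    let ?d = "delta (Suc j)" and ?k = "Suc j"
    have fc: "c ?k (x + ?d) (f x) \<in> V x"
      using unitary_betweenD(1)[OF elim(2), of "f x"] elim by simp
    have cC: "c ?k (x + ?d) (a *\<^sub>C f x) = a *\<^sub>C c ?k (x + ?d) (f x)" for a
      using unitary_betweenD(2)[OF elim(2), of "f x"] elim by simp
    have cC': "c ?k x (a *\<^sub>C c ?k (x + ?d) (f x)) = a *\<^sub>C c ?k x (c ?k (x + ?d) (f x))" for a
      by (rule unitary_betweenD(2)[OF elim(1) fc])
    have "J \<mu> c ?k (J' \<mu> c ?k f) x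
        = (- \<i> * parity_sign j x * (s ?k x * (parity_sign ?k (x + ?d) * s ?k (x + ?d)))) *\<^sub>C c ?k x (c ?k (x + ?d) (f x))"
      by (simp only: J_def J'_def scaleC_of_real[symmetric] binseq_add_cancel cC cC' scaleC_scaleC diff_Suc_1)
    also have "c ?k x (c ?k (x + ?d) (f x)) = f x" using elim by blast
    also have "- \<i> * parity_sign j x * (s ?k x * (parity_sign ?k (x + ?d) * s ?k (x + ?d)))
        = - \<i> * (parity_sign j x * parity_sign ?k (x + ?d)) * complex_of_real (s ?k x * s ?k (x + ?d))"
      by simp
    also have "s ?k x * s ?k (x + ?d) = 1" using elim by blast
    also have "parity_sign j x * parity_sign ?k (x + ?d) = - (if x j = 1 then -1 else 1)"
    proof -
      have "(if (x + ?d) j = 1 then -1 else 1) = (- (if x j = 1 then -1 else 1) :: complex)"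
        by (cases "x j") (simp_all add: delta_def)
      then show ?thesis
        by (simp only: parity_sign_Suc parity_sign_delta parity_sign_square mult.assoc[symmetric]) simp
    qed
    finally show ?case by simp
  qed
qed

end

section \<open>Antilinear isometries, and the real structure defined by a family\<close>

lemma antilinear_isometry_betweenD:
  assumes T: "antilinear_isometry_between W W' T" and u: "u \<in> W"
  shows "T u \<in> W'" "T (a *\<^sub>C u) = cnj a *\<^sub>C T u" "T (t *\<^sub>R u) = t *\<^sub>R T u" "norm (T u) = norm u"
    "v \<in> W \<Longrightarrow> T (a *\<^sub>C u + b *\<^sub>C v) = cnj a *\<^sub>C T u + cnj b *\<^sub>C T v"
proof -
  have lin: "T (a *\<^sub>C u + b *\<^sub>C v) = cnj a *\<^sub>C T u + cnj b *\<^sub>C T v" if "v \<in> W" for v a b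
    using T u that by (simp add: antilinear_isometry_between_def)
  show "T u \<in> W'" "norm (T u) = norm u"
    using T u by (auto simp: antilinear_isometry_between_def)
  show *: "T (a *\<^sub>C u) = cnj a *\<^sub>C T u" for a using lin[OF u, of a 0] by simp
  show "T (t *\<^sub>R u) = t *\<^sub>R T u" using *[of "complex_of_real t"] by (simp add: scaleC_of_real)
  show "T (a *\<^sub>C u + b *\<^sub>C v) = cnj a *\<^sub>C T u + cnj b *\<^sub>C T v" if "v \<in> W" by (rule lin[OF that])
qed

text \<open>Polarization: \<open>\<i> *\<^sub>C T u + T v\<close> is the image of
  \<open>(- \<i>) *\<^sub>C u + v\<close>, which is a unimodular multiple of
  \<open>\<i> *\<^sub>C v + u\<close>. This exchanges the roles of \<open>u\<close> and
  \<open>v\<close>.\<close>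

lemma antilinear_isometry_cinner:
  assumes T: "antilinear_isometry_between W W' T" and W: "complex_vector.subspace W"
    and u: "u \<in> W" and v: "v \<in> W"
  shows "cinner (T u) (T v) = cinner v u"
proof -
  have "norm (T u + T v) = norm (u + v)"
    using antilinear_isometry_betweenD(5)[OF T u v, of 1 1]
      antilinear_isometry_betweenD(4)[OF T complex_vector.subspace_add[OF W u v]] by simp
  moreover have "norm (\<i> *\<^sub>C T u + T v) = norm (\<i> *\<^sub>C v + u)"
  proof -
    have "(- \<i>) *\<^sub>C u + v \<in> W"
      by (intro complex_vector.subspace_add[OF W] complex_vector.subspace_scale[OF W] u v)
    then have "norm (\<i> *\<^sub>C T u + T v) = norm ((- \<i>) *\<^sub>C u + v)"
      using antilinear_isometry_betweenD(5)[OF T u v, of "- \<i>" 1] antilinear_isometry_betweenD(4)[OF T] by fastforce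
    also have "(- \<i>) *\<^sub>C u + v = (- \<i>) *\<^sub>C (\<i> *\<^sub>C v + u)"
      by (simp add: scaleC_add_right scaleC_scaleC)
    finally show ?thesis by (simp only: norm_scaleC) simp
  qed
  ultimately show ?thesis
    by (simp only: cinner_norm_polarization[of "T u"] cinner_norm_polarization[of v] add.commute[of v u]
        antilinear_isometry_betweenD(4)[OF T u] antilinear_isometry_betweenD(4)[OF T v])
       (simp add: algebra_simps)
qed

context gw_triple
begin

definition real_form_data :: "(binseq \<Rightarrow> 'h \<Rightarrow> 'h) \<Rightarrow> bool" where
  "real_form_data r \<longleftrightarrow> check_antilinear_family \<mu> V e r \<and>
      (AE x in \<mu>. \<forall>v\<in>V x. r x (r (check x) v) = v) \<and>
      (\<forall>k\<ge>1. AE x in \<mu>. \<forall>v\<in>V (check x).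
        r x (c k (check x) v) = (-1) ^ k *\<^sub>C c k x (r (x + delta k) v))"

text \<open>Norm preservation is the change of variables with density \<open>p\<close>, and
  \<open>S (S f) = f\<close> combines the involution property of \<open>r\<close> with
  \<open>p (check x) * p x = 1\<close>.\<close>

lemma real_structure_of_family:
  assumes p: "shift_density \<mu> 1 p" and r: "real_form_data r"
  shows "real_structure \<mu> V e c (\<lambda>f x. sqrt (p x) *\<^sub>R r x (f (check x)))"
proof -
  define S where "S f x = sqrt (p x) *\<^sub>R r x (f (check x))" for f x
  have pm [measurable]: "p \<in> borel_measurable borel" and p0: "\<And>x. 0 \<le> p x"
    using p by (simp_all add: shift_density_def)
  have anti: "AE x in \<mu>. antilinear_isometry_between (V (check x)) (V x) (r x)"
    and rmsec: "\<And>f. f \<in> msec \<Longrightarrow> (\<lambda>x. r x (f (check x))) \<in> msec"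
    and inv: "AE x in \<mu>. \<forall>v\<in>V x. r x (r (check x) v) = v"
    and comm: "\<And>k. 1 \<le> k \<Longrightarrow> AE x in \<mu>. \<forall>v\<in>V (check x).
        r x (c k (check x) v) = (-1) ^ k *\<^sub>C c k x (r (x + delta k) v)"
    using r unfolding real_form_data_def check_antilinear_family_def by blast+
  note AE_check = AE_shift[OF p]
  have norm_S: "(\<integral>\<^sup>+x. ennreal ((norm (S f x))\<^sup>2) \<partial>\<mu>) = (\<integral>\<^sup>+x. ennreal ((norm (f x))\<^sup>2) \<partial>\<mu>)" if f: "f \<in> msec" for f
  proof -
    note [measurable] = f
    have "AE x in \<mu>. ennreal ((norm (S f x))\<^sup>2) = ennreal (p x) * ennreal ((norm (f (check x)))\<^sup>2)"
      using anti AE_check[OF msec_in_V[OF f]]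
      by eventually_elim (simp add: S_def antilinear_isometry_betweenD(4) power_mult_distrib p0 ennreal_mult)
    then have "(\<integral>\<^sup>+x. ennreal ((norm (S f x))\<^sup>2) \<partial>\<mu>) = (\<integral>\<^sup>+x. ennreal (p x) * ennreal ((norm (f (check x)))\<^sup>2) \<partial>\<mu>)"
      by (rule nn_integral_cong_AE)
    also have "\<dots> = (\<integral>\<^sup>+x. ennreal ((norm (f x))\<^sup>2) \<partial>\<mu>)"
      by (rule nn_integral_shift[OF p]) measurable
    finally show ?thesis .
  qed
  have S_msec: "S f \<in> msec" if "f \<in> msec" for f
    unfolding S_def using rmsec[OF that] by (rule msec_scaleR) (simp add: borel_completion)
  \<comment> \<open>\<open>J\<close> and \<open>J'\<close> differ only in the scalar
    \<open>a\<close>. The hypothesis on \<open>a\<close> says that conjugation and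
    \<open>check\<close> together change it by exactly the sign in the relation for
    \<open>r\<close>.\<close>
  have S_twisted: "AE x in \<mu>. S (\<lambda>x. a x *\<^sub>C c k x (s k x *\<^sub>R f (x + delta k))) x
      = a x *\<^sub>C c k x (s k x *\<^sub>R S f (x + delta k))"
    if k: "1 \<le> k" and f: "f \<in> msec" and a: "\<And>x. cnj (a (check x)) * (-1) ^ k = a x" for a k f
    using anti AE_delta[OF anti, of k] comm[OF k] c_unitary[OF k] AE_check[OF c_unitary[OF k]] V_delta[of k]
      AE_check[OF V_delta[of k]] AE_check[OF AE_delta[OF msec_in_V[OF f], of k]]
      shift_density_commute[OF s_density[of k] p]
  proof eventually_elim
    case (elim x)
    have swap: "check (x + delta k) = check x + delta k" by (simp add: ac_simps)
    define v where "v = f (check x + delta k)"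
    have v: "v \<in> V (check x)" using elim(7,8) by (simp add: v_def)
    have cv: "c k (check x) v \<in> V (check x)" by (rule unitary_betweenD(1)[OF elim(5) v])
    have rv: "r (x + delta k) v \<in> V x"
      using antilinear_isometry_betweenD(1)[OF elim(2), of v] v elim(6,7) by (simp add: swap)
    \<comment> \<open>Translation by \<open>1\<close> and by \<open>delta k\<close> can be composed
      in either order, which gives two expressions for the same derivative.\<close>
    have "sqrt (p x) * s k (check x) = s k x * sqrt (p (x + delta k))"
    proof -
      have "sqrt ((s k (check x))\<^sup>2 * p x) = sqrt (p (x + delta k) * (s k x)\<^sup>2)" using elim(9) by simp
      then show ?thesis by (simp add: real_sqrt_mult s_nonneg mult.commute)
    qed
    then have sq: "complex_of_real (sqrt (p x)) * complex_of_real (s k (check x))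
        = complex_of_real (s k x) * complex_of_real (sqrt (p (x + delta k)))"
      by (metis of_real_mult)
    have "r x (a (check x) *\<^sub>C c k (check x) (s k (check x) *\<^sub>R v))
        = (cnj (a (check x)) * s k (check x)) *\<^sub>C r x (c k (check x) v)"
      by (simp add: unitary_betweenD(2)[OF elim(5) v] scaleC_scaleC antilinear_isometry_betweenD(2)[OF elim(1) cv]
          flip: scaleC_of_real)
    also have "r x (c k (check x) v) = (-1) ^ k *\<^sub>C c k x (r (x + delta k) v)"
      using elim(3) v by blast
    finally have "S (\<lambda>x. a x *\<^sub>C c k x (s k x *\<^sub>R f (x + delta k))) x
        = (sqrt (p x) * (cnj (a (check x)) * s k (check x) * (-1) ^ k)) *\<^sub>C c k x (r (x + delta k) v)"
      by (simp only: S_def v_def[symmetric] scaleC_scaleC scaleC_of_real[symmetric])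
    also have "sqrt (p x) * (cnj (a (check x)) * s k (check x) * (-1) ^ k)
        = (cnj (a (check x)) * (-1) ^ k) * (complex_of_real (sqrt (p x)) * complex_of_real (s k (check x)))"
      by (simp only: ac_simps)
    also have "\<dots> = a x * (complex_of_real (s k x) * complex_of_real (sqrt (p (x + delta k))))"
      by (simp only: a sq)
    also have "\<dots> *\<^sub>C c k x (r (x + delta k) v) = a x *\<^sub>C c k x (s k x *\<^sub>R S f (x + delta k))"
      by (simp only: S_def swap v_def[symmetric] scaleC_of_real[symmetric] scaleC_scaleC
          unitary_betweenD(2)[OF elim(4) rv])
    finally show ?case .
  qed
  have S_J: "AE x in \<mu>. S (J \<mu> c k f) x = J \<mu> c k (S f) x" if k: "1 \<le> k" and f: "f \<in> L2" for k f
    unfolding J_def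
  proof (rule S_twisted[OF k L2_msec[OF f]])
    fix x
    obtain j where "k = Suc j" using k by (cases k) auto
    \<comment> \<open>With \<open>k = Suc j\<close>, the parity sign contributes (-1)^j, conjugating
      -\<i> contributes -1, and the relation for \<open>r\<close> contributes (-1)^(j+1); the
      product is 1.\<close>
    then have "cnj (- \<i> * parity_sign (k - 1) (check x)) * (-1) ^ k
        = \<i> * ((-1) ^ j * parity_sign j x) * (- ((-1) ^ j))"
      by (simp add: parity_sign_check cnj_parity_sign)
    also have "\<dots> = - \<i> * parity_sign j x * ((-1) ^ j * (-1) ^ j)"
      by (simp only: mult_minus_left mult_minus_right ac_simps)
    also have "(-1) ^ j * (-1) ^ j = (1::complex)"
      by (simp flip: power_mult_distrib)
    finally show "cnj (- \<i> * parity_sign (k - 1) (check x)) * (-1) ^ k = - \<i> * parity_sign (k - 1) x"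
      by (simp only: \<open>k = Suc j\<close> diff_Suc_1 mult_1_right)
  qed
  have S_J': "AE x in \<mu>. S (J' \<mu> c k f) x = J' \<mu> c k (S f) x" if k: "1 \<le> k" and f: "f \<in> L2" for k f
    unfolding J'_def
    by (rule S_twisted[OF k L2_msec[OF f]])
       (simp add: parity_sign_check cnj_parity_sign power_mult_distrib[symmetric])
  have "real_structure \<mu> V e c S"
    unfolding real_structure_def
  proof (intro conjI ballI allI impI)
    show "S f \<in> L2" if "f \<in> L2" for f
      using that S_msec norm_S by (simp add: L2_iff)
    show "AE x in \<mu>. S f x = S g x" if "AE x in \<mu>. f x = g x" for f g
      using AE_check[OF that] by eventually_elim (simp add: S_def)
    show "AE x in \<mu>. S (\<lambda>y. a *\<^sub>C f y + b *\<^sub>C g y) x = cnj a *\<^sub>C S f x + cnj b *\<^sub>C S g x"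
      if f: "f \<in> L2" and g: "g \<in> L2" for f g a b
      using anti AE_check[OF msec_in_V[OF L2_msec[OF f]]] AE_check[OF msec_in_V[OF L2_msec[OF g]]]
    proof eventually_elim
      case (elim x)
      show ?case
        by (simp only: S_def antilinear_isometry_betweenD(5)[OF elim(1-3)] scaleC_of_real[symmetric]
            scaleC_add_right scaleC_scaleC mult.commute)
    qed
    show "L2_norm \<mu> (S f) = L2_norm \<mu> f" if "f \<in> L2" for f
      using L2_msec[OF that] by (simp add: L2_norm_eq S_msec norm_S)
    show "AE x in \<mu>. S (S f) x = f x" if f: "f \<in> L2" for f
      using anti AE_check[OF anti] inv msec_in_V[OF L2_msec[OF f]] shift_density_involution[OF p]
    proof eventually_elim
      case (elim x)
      have fx: "f x \<in> V (check (check x))" using elim(4) by simp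
      have "sqrt (p x) * sqrt (p (check x)) = 1"
        using elim(5) by (simp add: mult.commute flip: real_sqrt_mult)
      moreover have "r x (r (check x) (f x)) = f x" using elim(3,4) by blast
      ultimately show ?case
        by (simp add: S_def antilinear_isometry_betweenD(3)[OF elim(1)] antilinear_isometry_betweenD(1)[OF elim(2) fx])
    qed
  qed (use S_J S_J' in auto)
  moreover have "S = (\<lambda>f x. sqrt (p x) *\<^sub>R r x (f (check x)))"
    by (intro ext) (simp add: S_def)
  ultimately show ?thesis by simp
qed

end

subsection \<open>Borel sets and cylinders\<close>

text \<open>Contradictory prescriptions are allowed and give the empty set, so intersecting
  cylinders is just taking the union of the prescriptions.\<close>

definition cylinder :: "(nat \<times> bit) set \<Rightarrow> binseq set" where
  "cylinder P = {x. \<forall>(j, b)\<in>P. x j = b}"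

lemma cylinder_insert: "cylinder (insert (j, b) P) = {x. x j = b} \<inter> cylinder P"
  by (auto simp: cylinder_def)

lemma cylinder_borel: "finite P \<Longrightarrow> cylinder P \<in> sets borel"
proof (induction P rule: finite_induct)
  case empty
  show ?case by (simp add: cylinder_def)
next
  case (insert q P)
  then show ?case by (cases q) (simp only: cylinder_insert sets.Int coordinate_set_borel)
qed

text \<open>The Borel sets of the countable product are generated by coordinate events, and each of
  these is a finite union of cylinders because a coordinate has two values.\<close>

lemma sets_borel_cylinders: "sets (borel :: binseq measure) = sigma_sets UNIV (cylinder ` Collect finite)"
proof (rule antisym)
  show "sigma_sets UNIV (cylinder ` Collect finite) \<subseteq> sets borel"
    using sets.sigma_sets_subset[of "cylinder ` Collect finite" borel] cylinder_borel by fastforce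
  have "sets (borel :: binseq measure) = sets (Pi\<^sub>M UNIV (\<lambda>i::nat. borel :: bit measure))"
    by (rule sets_PiM_equal_borel[symmetric])
  also have "\<dots> \<subseteq> sigma_sets UNIV (cylinder ` Collect finite)"
    unfolding sets_PiM_single space_borel PiE_UNIV_domain Pi_UNIV
  proof (rule sigma_sets_mono)
    let ?C = "cylinder ` Collect finite"
    have one: "{x. x i = b} \<in> ?C" for i b
      by (rule image_eqI[of _ _ "{(i, b)}"]) (auto simp: cylinder_def)
    show "{{f \<in> UNIV. f i \<in> A} |i A. i \<in> UNIV \<and> A \<in> sets borel} \<subseteq> sigma_sets UNIV ?C"
    proof clarify
      fix i :: nat and A :: "bit set"
      have "(\<Union>b\<in>A. {x :: binseq. x i = b}) \<in> sigma_sets UNIV ?C"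
        using one by (intro sigma_sets_UNION countable_finite) (auto intro: sigma_sets.Basic)
      also have "(\<Union>b\<in>A. {x :: binseq. x i = b}) = {f \<in> UNIV. f i \<in> A}" by auto
      finally show "{f \<in> UNIV. f i \<in> A} \<in> sigma_sets UNIV ?C" .
    qed
  qed
  finally show "sets (borel :: binseq measure) \<subseteq> sigma_sets UNIV (cylinder ` Collect finite)" .
qed

lemma Int_stable_cylinders: "Int_stable (cylinder ` Collect finite)"
proof (rule Int_stableI_image)
  show "\<exists>R\<in>Collect finite. cylinder P \<inter> cylinder Q = cylinder R" if "P \<in> Collect finite" "Q \<in> Collect finite" for P Q
    using that by (intro bexI[of _ "P \<union> Q"]) (simp_all add: cylinder_def ball_Un Collect_conj_eq)
qed

text \<open>The reciprocal of \<open>p\<close> is its own translate, by the involution identity, and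
  serves as the density in the other direction.\<close>

lemma (in binseq_measure) equivalent_translate:
  assumes p: "shift_density \<mu> a p"
  shows "equivalent_measures \<mu> (translate a \<mu>)"
  unfolding equivalent_measures_def
proof
  show "has_derivative_wrt (translate a \<mu>) \<mu>" using p has_derivative_wrt_translate by blast
  have [measurable]: "p \<in> borel_measurable borel" and p0: "\<And>x. 0 \<le> p x"
    and tr: "translate a \<mu> = density \<mu> (\<lambda>x. ennreal (p x))"
    using p by (simp_all add: shift_density_def)
  have pa: "(\<lambda>x. p (x + a)) \<in> borel_measurable borel" by measurable
  have "density (translate a \<mu>) (\<lambda>x. ennreal (p (x + a))) = density \<mu> (\<lambda>x. ennreal (p x) * ennreal (p (x + a)))"
    unfolding tr using pa by (intro density_density_eq) (simp_all add: measurable_mu)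
  also have "\<dots> = density \<mu> (\<lambda>_. 1)"
    using shift_density_involution[OF p] pa
    by (intro density_cong) (auto simp: measurable_mu p0 mult.commute simp flip: ennreal_mult elim: eventually_mono)
  finally have "\<mu> = density (translate a \<mu>) (\<lambda>x. ennreal (p (x + a)))" by (simp add: density_1)
  moreover have "(\<lambda>x. p (x + a)) \<in> borel_measurable (translate a \<mu>)"
    using pa by (simp add: translate_def)
  ultimately show "has_derivative_wrt \<mu> (translate a \<mu>)"
    unfolding has_derivative_wrt_def using p0 by blast
qed

section \<open>Measures attached to an invariant real structure\<close>

locale real_form = gw_triple +
  fixes S
  assumes rs: "real_structure \<mu> V e c S"
begin

lemma S_L2: "f \<in> L2 \<Longrightarrow> S f \<in> L2"
  using rs unfolding real_structure_def by blast

lemma S_cong: "f \<in> L2 \<Longrightarrow> g \<in> L2 \<Longrightarrow> AE x in \<mu>. f x = g x \<Longrightarrow> AE x in \<mu>. S f x = S g x"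
  using rs unfolding real_structure_def by blast

lemma S_antilinear: "f \<in> L2 \<Longrightarrow> g \<in> L2 \<Longrightarrow>
    AE x in \<mu>. S (\<lambda>y. a *\<^sub>C f y + b *\<^sub>C g y) x = cnj a *\<^sub>C S f x + cnj b *\<^sub>C S g x"
  using rs unfolding real_structure_def by blast

lemma S_norm:
  assumes f: "f \<in> L2"
  shows "(\<integral>\<^sup>+x. ennreal ((norm (S f x))\<^sup>2) \<partial>\<mu>) = (\<integral>\<^sup>+x. ennreal ((norm (f x))\<^sup>2) \<partial>\<mu>)"
proof -
  have "L2_norm \<mu> (S f) = L2_norm \<mu> f"
    using rs f unfolding real_structure_def by blast
  then have "enn2real (\<integral>\<^sup>+x. ennreal ((norm (S f x))\<^sup>2) \<partial>\<mu>) = enn2real (\<integral>\<^sup>+x. ennreal ((norm (f x))\<^sup>2) \<partial>\<mu>)"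
    using f S_L2[OF f] by (simp add: L2_norm_eq L2_msec)
  moreover have "(\<integral>\<^sup>+x. ennreal ((norm (S f x))\<^sup>2) \<partial>\<mu>) < top" "(\<integral>\<^sup>+x. ennreal ((norm (f x))\<^sup>2) \<partial>\<mu>) < top"
    using f S_L2[OF f] by (simp_all add: L2_iff)
  ultimately show ?thesis by (metis ennreal_enn2real)
qed

lemma S_involution: "f \<in> L2 \<Longrightarrow> AE x in \<mu>. S (S f) x = f x"
  using rs unfolding real_structure_def by blast

lemma S_J: "1 \<le> k \<Longrightarrow> f \<in> L2 \<Longrightarrow> AE x in \<mu>. S (J \<mu> c k f) x = J \<mu> c k (S f) x"
  using rs unfolding real_structure_def by blast

lemma S_J': "1 \<le> k \<Longrightarrow> f \<in> L2 \<Longrightarrow> AE x in \<mu>. S (J' \<mu> c k f) x = J' \<mu> c k (S f) x"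
  using rs unfolding real_structure_def by blast

lemma indicator_L2:
  assumes "f \<in> L2" "A \<in> sets borel"
  shows "(\<lambda>x. indicator A x *\<^sub>C f x) \<in> L2"
  using assms by (intro L2_bounded_multiple) (auto intro!: borel_completion split: split_indicator)

text \<open>The indicator is \<open>1 / 2 + t * sg x\<close>, where multiplication by
  \<open>sg\<close> is a Clifford element and so commutes with \<open>S\<close>. Antilinearity
  conjugates \<open>t\<close>, and this turns the indicator into its composition with
  \<open>check\<close>.\<close>

lemma S_coordinate:
  assumes f: "f \<in> L2"
  shows "AE x in \<mu>. S (\<lambda>x. indicator {x. x j = b} x *\<^sub>C f x) x = indicator {x. x j = b} (check x) *\<^sub>C S f x"
proof -
  define sg :: "binseq \<Rightarrow> complex" where "sg x = \<i> * (if x j = 1 then -1 else 1)" for x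
  \<comment> \<open>As \<open>sg\<close> takes the values \<plusminus>\<i>, an imaginary
    \<open>t\<close> of modulus 1/2 makes \<open>t * sg x\<close> equal to \<plusminus>1/2;
    conjugation reverses its sign.\<close>
  define t where "t = (if b = 0 then - \<i> / 2 else \<i> / 2)"
  define g where "g = J \<mu> c (Suc j) (J' \<mu> c (Suc j) f)"
  have g: "g \<in> L2" unfolding g_def using f by (intro J_L2 J'_L2) simp_all
  have ind: "indicator {x. x j = b} x = 1 / 2 + t * sg x" for x
    by (cases b; cases "x j") (simp_all add: t_def sg_def indicator_def)
  have ind': "indicator {x. x j = b} (check x) = 1 / 2 + cnj t * sg x" for x
    by (cases b; cases "x j") (simp_all add: t_def sg_def indicator_def)
  have gf: "AE x in \<mu>. g x = sg x *\<^sub>C f x"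
    using J_J'[OF f, of j] by (simp add: g_def sg_def)
  have "AE x in \<mu>. S (\<lambda>x. indicator {x. x j = b} x *\<^sub>C f x) x = S (\<lambda>x. (1 / 2) *\<^sub>C f x + t *\<^sub>C g x) x"
  proof (rule S_cong[OF indicator_L2[OF f coordinate_set_borel] L2_combination[OF f g]])
    show "AE x in \<mu>. indicator {x. x j = b} x *\<^sub>C f x = (1 / 2) *\<^sub>C f x + t *\<^sub>C g x"
      using gf by eventually_elim (simp only: ind scaleC_add_left scaleC_scaleC)
  qed
  moreover have "AE x in \<mu>. S g x = J \<mu> c (Suc j) (S (J' \<mu> c (Suc j) f)) x"
    unfolding g_def using f by (intro S_J J'_L2) simp_all
  moreover have "AE x in \<mu>. J \<mu> c (Suc j) (S (J' \<mu> c (Suc j) f)) x = J \<mu> c (Suc j) (J' \<mu> c (Suc j) (S f)) x"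
    using f by (intro J_cong S_J') simp_all
  moreover have "AE x in \<mu>. J \<mu> c (Suc j) (J' \<mu> c (Suc j) (S f)) x = sg x *\<^sub>C S f x"
    unfolding sg_def by (rule J_J'[OF S_L2[OF f]])
  ultimately show ?thesis
    using S_antilinear[OF f g, of "1 / 2" t]
  proof eventually_elim
    case (elim x)
    have Sg: "S g x = sg x *\<^sub>C S f x" using elim(2-4) by (rule trans[OF trans])
    show ?case
      by (simp only: elim(1,5) Sg ind' scaleC_add_left scaleC_scaleC complex_cnj_divide complex_cnj_one complex_cnj_numeral)
  qed
qed

lemma S_cylinder:
  assumes "finite P" "f \<in> L2"
  shows "AE x in \<mu>. S (\<lambda>x. indicator (cylinder P) x *\<^sub>C f x) x = indicator (cylinder P) (check x) *\<^sub>C S f x"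
  using assms
proof (induction P rule: finite_induct)
  case empty
  then show ?case by (simp add: cylinder_def)
next
  case (insert q P)
  obtain j b where q: "q = (j, b)" by (cases q)
  let ?h = "\<lambda>x. indicator (cylinder P) x *\<^sub>C f x"
  have h: "?h \<in> L2" by (rule indicator_L2[OF insert.prems cylinder_borel[OF insert.hyps(1)]])
  have eq: "(\<lambda>x. indicator (cylinder (insert q P)) x *\<^sub>C f x) = (\<lambda>x. indicator {x. x j = b} x *\<^sub>C ?h x)"
    by (simp add: q cylinder_insert indicator_inter_arith scaleC_scaleC)
  show ?case
    unfolding eq using S_coordinate[OF h, of j b] insert.IH[OF insert.prems]
    by eventually_elim (simp only: q cylinder_insert indicator_inter_arith scaleC_scaleC)
qed

lemma S_norm_measure:
  assumes f: "f \<in> L2" and A: "A \<in> sets borel"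
  shows "(\<integral>\<^sup>+x. ennreal ((norm (S f x))\<^sup>2) * indicator A x \<partial>\<mu>)
       = (\<integral>\<^sup>+x. ennreal ((norm (f x))\<^sup>2) * indicator A (check x) \<partial>\<mu>)"
proof -
  note [measurable] = L2_msec[OF f] L2_msec[OF S_L2[OF f]]
  \<comment> \<open>Norms of sections are measurable only for the completion; the Borel versions
    \<open>G\<close> and \<open>H\<close> define measures on the Borel sets.\<close>
  have "(\<lambda>x. ennreal ((norm (f x))\<^sup>2)) \<in> borel_measurable M" by measurable
  then obtain G where G: "G \<in> borel_measurable \<mu>" "AE x in \<mu>. ennreal ((norm (f x))\<^sup>2) = G x"
    using completion_ex_borel_measurable by blast
  have "(\<lambda>x. ennreal ((norm (S f x))\<^sup>2)) \<in> borel_measurable M" by measurable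
  then obtain H where H: "H \<in> borel_measurable \<mu>" "AE x in \<mu>. ennreal ((norm (S f x))\<^sup>2) = H x"
    using completion_ex_borel_measurable by blast
  have sh: "check \<in> density \<mu> G \<rightarrow>\<^sub>M borel" by (simp add: measurable_mu)
  have em_H: "emeasure (density \<mu> H) B = (\<integral>\<^sup>+x. ennreal ((norm (S f x))\<^sup>2) * indicator B x \<partial>\<mu>)"
    if "B \<in> sets borel" for B
    using that H by (subst emeasure_density) (auto simp: sets_mu intro!: nn_integral_cong_AE elim: eventually_mono)
  have em_G: "emeasure (distr (density \<mu> G) borel check) B
      = (\<integral>\<^sup>+x. ennreal ((norm (f x))\<^sup>2) * indicator B (check x) \<partial>\<mu>)" if B: "B \<in> sets borel" for B
  proof -
    have "emeasure (distr (density \<mu> G) borel check) B = emeasure (density \<mu> G) (check -` B)"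
      using emeasure_distr[OF sh B] by simp
    also have "\<dots> = (\<integral>\<^sup>+x. G x * indicator (check -` B) x \<partial>\<mu>)"
      using measurable_sets[OF sh B] G(1) by (intro emeasure_density) simp_all
    also have "\<dots> = (\<integral>\<^sup>+x. ennreal ((norm (f x))\<^sup>2) * indicator B (check x) \<partial>\<mu>)"
      by (rule nn_integral_cong_AE) (use G(2) in \<open>eventually_elim, simp add: indicator_def\<close>)
    finally show ?thesis .
  qed
  have "density \<mu> H = distr (density \<mu> G) borel check"
  proof (rule measure_eqI_generator_eq[OF Int_stable_cylinders, where \<Omega> = UNIV and A = "\<lambda>_. cylinder {}"])
    show "sets (density \<mu> H) = sigma_sets UNIV (cylinder ` Collect finite)"
      by (simp add: sets_mu sets_borel_cylinders)
    show "sets (distr (density \<mu> G) borel check) = sigma_sets UNIV (cylinder ` Collect finite)"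
      by (simp add: sets_borel_cylinders)
    \<comment> \<open>Uniqueness of the extension from cylinders needs finite total mass, and here
      square integrability enters.\<close>
    have "cylinder {} = UNIV" by (simp add: cylinder_def)
    then show "emeasure (density \<mu> H) (cylinder {}) \<noteq> \<infinity>"
      using S_L2[OF f] by (simp add: em_H L2_iff less_top)
    show "emeasure (density \<mu> H) X = emeasure (distr (density \<mu> G) borel check) X" if XC: "X \<in> cylinder ` Collect finite" for X
    proof -
      obtain P where P: "finite P" "X = cylinder P" using XC by blast
      have X: "X \<in> sets borel" unfolding P(2) by (rule cylinder_borel[OF P(1)])
      define Y where "Y = check -` X"
      have Y: "Y \<in> sets borel" using measurable_sets[OF measurable_shift X] by (simp add: Y_def)
      \<comment> \<open>Flipping the prescribed values shows that the preimage of a cylinder under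
        \<open>check\<close> is again a cylinder.\<close>
      let ?P' = "(\<lambda>(j, b). (j, b + 1)) ` P"
      have "Y = cylinder ?P'"
      proof -
        have "x + 1 = b \<longleftrightarrow> x = b + 1" for x b :: bit by (cases x; cases b) simp_all
        then show ?thesis by (simp only: Y_def P(2) cylinder_def) auto
      qed
      then have "AE x in \<mu>. S (\<lambda>x. indicator Y x *\<^sub>C f x) x = indicator Y (check x) *\<^sub>C S f x"
        using S_cylinder[OF _ f, of ?P'] P(1) by simp
      then have "(\<integral>\<^sup>+x. ennreal ((norm (S f x))\<^sup>2) * indicator X x \<partial>\<mu>)
          = (\<integral>\<^sup>+x. ennreal ((norm (S (\<lambda>x. indicator Y x *\<^sub>C f x) x))\<^sup>2) \<partial>\<mu>)"
        by (intro nn_integral_cong_AE) (erule eventually_mono, simp add: Y_def indicator_def)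
      also have "\<dots> = (\<integral>\<^sup>+x. ennreal ((norm (indicator Y x *\<^sub>C f x))\<^sup>2) \<partial>\<mu>)"
        by (rule S_norm[OF indicator_L2[OF f Y]])
      also have "\<dots> = (\<integral>\<^sup>+x. ennreal ((norm (f x))\<^sup>2) * indicator X (check x) \<partial>\<mu>)"
        by (intro nn_integral_cong) (simp add: Y_def indicator_def)
      finally show ?thesis using X by (simp add: em_H em_G)
    qed
  qed (auto simp: cylinder_def)
  then show ?thesis using em_H[OF A] em_G[OF A] by simp
qed

text \<open>If \<open>A\<close> is null, then \<open>S f\<close> has no mass on \<open>A\<close>, so
  \<open>f\<close> vanishes almost everywhere on the preimage of \<open>A\<close>. Applied to all
  rescaled \<open>e n\<close>, this makes the fibres over that preimage zero, which is excluded
  almost everywhere.\<close>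

lemma check_density_exists: "\<exists>p. shift_density \<mu> 1 p"
proof (rule shift_density_exI)
  fix A assume A: "A \<in> null_sets \<mu>"
  then have Ab: "A \<in> sets borel" by (auto simp: sets_mu)
  obtain w :: "nat \<Rightarrow> binseq \<Rightarrow> real" where w: "\<And>n. w n \<in> borel_measurable M" "\<And>n x. 0 < w n x"
    and F: "\<And>n. (\<lambda>x. w n x *\<^sub>R e n x) \<in> L2"
    using fundamental_L2 by blast
  have Y: "check -` A \<in> sets borel" using measurable_sets[OF measurable_shift Ab] by simp
  have "AE x in \<mu>. check x \<notin> A \<or> e n x = 0" for n
  proof -
    note [measurable] = L2_msec[OF F[of n]]
    have [measurable]: "(\<lambda>x. indicator A (check x) :: ennreal) \<in> borel_measurable M"
      by (rule borel_completion[OF measurable_compose[OF measurable_shift borel_measurable_indicator[OF Ab]]])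
    have "(\<integral>\<^sup>+x. ennreal ((norm (w n x *\<^sub>R e n x))\<^sup>2) * indicator A (check x) \<partial>M)
        = (\<integral>\<^sup>+x. ennreal ((norm (S (\<lambda>x. w n x *\<^sub>R e n x) x))\<^sup>2) * indicator A x \<partial>\<mu>)"
      unfolding nn_integral_completion by (rule S_norm_measure[OF F Ab, symmetric])
    also have "\<dots> = (\<integral>\<^sup>+x. 0 \<partial>\<mu>)"
      using AE_not_in[OF A] by (intro nn_integral_cong_AE) (auto elim: eventually_mono)
    finally have z: "(\<integral>\<^sup>+x. ennreal ((norm (w n x *\<^sub>R e n x))\<^sup>2) * indicator A (check x) \<partial>M) = 0" by simp
    have "(\<lambda>x. ennreal ((norm (w n x *\<^sub>R e n x))\<^sup>2) * indicator A (check x)) \<in> borel_measurable M"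
      by measurable
    from nn_integral_0_iff_AE[OF this] z
    have "AE x in M. ennreal ((norm (w n x *\<^sub>R e n x))\<^sup>2) * indicator A (check x) = 0" by simp
    then have "AE x in \<mu>. ennreal ((norm (w n x *\<^sub>R e n x))\<^sup>2) * indicator A (check x) = 0"
      by (simp only: AE_completion_iff)
    then show ?thesis
    proof eventually_elim
      case (elim x)
      have "w n x \<noteq> 0" using w(2)[of n x] by simp
      with elim show ?case by (auto simp: indicator_def split: if_splits)
    qed
  qed
  then have "AE x in \<mu>. \<forall>n. check x \<notin> A \<or> e n x = 0" unfolding AE_all_countable by blast
  moreover have "AE x in \<mu>. V x \<noteq> {0}" using gw by (simp add: GW_triple_def)
  ultimately have "AE x in \<mu>. x \<notin> check -` A"
  proof eventually_elim
    case (elim x)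
    have "V x = {0}" if "check x \<in> A"
    proof -
      have "range (\<lambda>n. e n x) = {0}" using elim(1) that by auto
      then show ?thesis by (simp add: V_eq complex_vector.span_singleton image_def)
    qed
    with elim(2) show ?case by auto
  qed
  then show "check -` A \<in> null_sets \<mu>"
    using Y by (subst AE_iff_null_sets) (simp_all add: sets_mu)
qed

text \<open>After the change of variables in \<open>S_norm_measure\<close>, both sides have the same
  integral over every Borel set, and densities are unique.\<close>

lemma S_norm_pointwise:
  assumes p: "shift_density \<mu> 1 p" and f: "f \<in> L2"
  shows "AE x in \<mu>. (norm (S f x))\<^sup>2 = p x * (norm (f (check x)))\<^sup>2"
proof -
  note [measurable] = L2_msec[OF f] L2_msec[OF S_L2[OF f]]
  have [measurable]: "p \<in> borel_measurable M" and p0: "\<And>x. 0 \<le> p x"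
    using p by (simp_all add: shift_density_def borel_completion)
  have [measurable]: "(\<lambda>x. norm (f (check x))) \<in> borel_measurable M"
    by (rule measurable_completion_shift[OF p]) measurable
  have "(\<lambda>x. ennreal (p x * (norm (f (check x)))\<^sup>2)) \<in> borel_measurable M" by measurable
  then obtain K where K: "K \<in> borel_measurable \<mu>" "AE x in \<mu>. ennreal (p x * (norm (f (check x)))\<^sup>2) = K x"
    using completion_ex_borel_measurable by blast
  have "(\<lambda>x. ennreal ((norm (S f x))\<^sup>2)) \<in> borel_measurable M" by measurable
  then obtain H where H: "H \<in> borel_measurable \<mu>" "AE x in \<mu>. ennreal ((norm (S f x))\<^sup>2) = H x"
    using completion_ex_borel_measurable by blast
  have "density \<mu> H = density \<mu> K"
  proof (rule measure_eqI)
    fix A assume "A \<in> sets (density \<mu> H)"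
    then have A: "A \<in> sets borel" by (simp add: sets_mu)
    have [measurable]: "(\<lambda>x. indicator A (check x) :: ennreal) \<in> borel_measurable M"
      by (rule borel_completion[OF measurable_compose[OF measurable_shift borel_measurable_indicator[OF A]]])
    have "emeasure (density \<mu> H) A = (\<integral>\<^sup>+x. H x * indicator A x \<partial>\<mu>)"
      using A H(1) by (intro emeasure_density) (simp_all add: sets_mu)
    also have "\<dots> = (\<integral>\<^sup>+x. ennreal ((norm (S f x))\<^sup>2) * indicator A x \<partial>\<mu>)"
      by (rule nn_integral_cong_AE) (use H(2) in \<open>eventually_elim, simp\<close>)
    also have "\<dots> = (\<integral>\<^sup>+x. ennreal ((norm (f x))\<^sup>2) * indicator A (check x) \<partial>\<mu>)"
      by (rule S_norm_measure[OF f A])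
    also have "\<dots> = (\<integral>\<^sup>+x. ennreal (p x) * (ennreal ((norm (f (check x)))\<^sup>2) * indicator A (check (check x))) \<partial>\<mu>)"
      by (rule nn_integral_shift[OF p, symmetric]) measurable
    also have "\<dots> = (\<integral>\<^sup>+x. K x * indicator A x \<partial>\<mu>)"
      by (rule nn_integral_cong_AE)
        (use K(2) in \<open>eventually_elim, simp add: p0 ennreal_mult mult.assoc[symmetric]\<close>)
    also have "\<dots> = emeasure (density \<mu> K) A"
      using A K(1) by (intro emeasure_density[symmetric]) (simp_all add: sets_mu)
    finally show "emeasure (density \<mu> H) A = emeasure (density \<mu> K) A" .
  qed simp
  then have "AE x in \<mu>. H x = K x" using density_unique_iff[OF H(1) K(1)] by simp
  with H(2) K(2) show ?thesis
  proof eventually_elim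
    case (elim x)
    then have "ennreal ((norm (S f x))\<^sup>2) = ennreal (p x * (norm (f (check x)))\<^sup>2)" by simp
    then show ?case using p0[of x] by (subst (asm) ennreal_inj) simp_all
  qed
qed

end

subsection \<open>From a real structure to a family of antilinear operators\<close>

text \<open>Antilinearity gives equality on the span, isometry gives continuity. This carries the
  relation for \<open>r\<close> from countably many vectors to a whole fibre.\<close>

lemma antilinear_isometries_eq_on_closure_span:
  assumes T: "antilinear_isometry_between W X T" and U: "antilinear_isometry_between W Y U"
    and W: "W = closure (complex_vector.span B)" and eq: "\<And>b. b \<in> B \<Longrightarrow> T b = U b" and v: "v \<in> W"
  shows "T v = U v"
proof -
  have sub: "complex_vector.subspace W" unfolding W by (rule subspace_closure_span)
  have span_W: "complex_vector.span B \<subseteq> W" unfolding W by (rule closure_subset)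
  have on_span: "T u = U u \<and> u \<in> W" if "u \<in> complex_vector.span B" for u
    using that
  proof (induction rule: complex_vector.span_induct_alt)
    case base
    have "(0::'a) \<in> W" by (rule complex_vector.subspace_0[OF sub])
    from antilinear_isometry_betweenD(4)[OF T this] antilinear_isometry_betweenD(4)[OF U this]
    show ?case using \<open>0 \<in> W\<close> by simp
  next
    case (step a x y)
    have x: "x \<in> W" by (rule subsetD[OF span_W complex_vector.span_base[OF step(1)]])
    have y: "y \<in> W" using step(2) by simp
    have "a *\<^sub>C x + y \<in> W"
      by (rule complex_vector.subspace_add[OF sub complex_vector.subspace_scale[OF sub x] y])
    with antilinear_isometry_betweenD(5)[OF T x y, of a 1] antilinear_isometry_betweenD(5)[OF U x y, of a 1]
    show ?case using eq[OF step(1)] step(2) by simp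
  qed
  have dist: "norm (R u - R v) = norm (u - v)" if "antilinear_isometry_between W Z R" "u \<in> W" for R Z u
  proof -
    have "u - v \<in> W" by (rule complex_vector.subspace_diff[OF sub that(2) v])
    moreover have "R (u - v) = R u - R v"
      using antilinear_isometry_betweenD(5)[OF that v, of 1 "-1"] by (simp add: scaleC_minus1)
    ultimately show ?thesis using antilinear_isometry_betweenD(4)[OF that(1)] by metis
  qed
  obtain q where q: "\<And>n. q n \<in> complex_vector.span B" "q \<longlonglongrightarrow> v"
    using v unfolding W closure_sequential by metis
  have lim: "(\<lambda>n. R (q n)) \<longlonglongrightarrow> R v" if "antilinear_isometry_between W Z R" for R Z
  proof -
    have "norm (R (q n) - R v) = norm (q n - v)" for n
      using dist[OF that] q(1) span_W by blast
    then show ?thesis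
      using q(2) by (simp only: tendsto_dist_iff[of _ "R v"] tendsto_dist_iff[of _ v] dist_norm)
  qed
  show ?thesis
  proof (rule LIMSEQ_unique[OF lim[OF T]])
    show "(\<lambda>n. T (q n)) \<longlonglongrightarrow> U v" using lim[OF U] on_span[OF q(1)] by (simp only:)
  qed
qed

text \<open>With the next lemma: each side of the relation for \<open>r\<close> is an antilinear
  isometry, so the two can be compared on a spanning set.\<close>

lemma antilinear_isometry_unitary:
  assumes U: "unitary_between W W U" and T: "antilinear_isometry_between W W' T"
  shows "antilinear_isometry_between W W' (\<lambda>v. T (U v))"
proof -
  have in_W: "U u \<in> W" if "u \<in> W" for u by (rule unitary_betweenD(1)[OF U that])
  have lin: "U (a *\<^sub>C u + b *\<^sub>C v) = a *\<^sub>C U u + b *\<^sub>C U v" if "u \<in> W" "v \<in> W" for u v a b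
    using U that by (simp add: unitary_between_def)
  show ?thesis
    unfolding antilinear_isometry_between_def
    using in_W lin antilinear_isometry_betweenD(1,4,5)[OF T] unitary_betweenD(3)[OF U] by auto
qed

lemma unitary_antilinear_isometry:
  assumes T: "antilinear_isometry_between W W' T" and U: "unitary_between W' W' U"
    and W': "complex_vector.subspace W'" and z: "cmod z = 1"
  shows "antilinear_isometry_between W W' (\<lambda>v. z *\<^sub>C U (T v))"
proof -
  have in_W': "T u \<in> W'" if "u \<in> W" for u by (rule antilinear_isometry_betweenD(1)[OF T that])
  have lin: "U (a *\<^sub>C u + b *\<^sub>C v) = a *\<^sub>C U u + b *\<^sub>C U v" if "u \<in> W'" "v \<in> W'" for u v a b
    using U that by (simp add: unitary_between_def)
  show ?thesis
    unfolding antilinear_isometry_between_def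
    using in_W' lin antilinear_isometry_betweenD(4,5)[OF T] unitary_betweenD(1,3)[OF U]
    by (auto simp: norm_scaleC z scaleC_add_right scaleC_scaleC mult.commute intro!: complex_vector.subspace_scale[OF W'])
qed

text \<open>Orthonormality survives the exchange of arguments, its values being symmetric. For
  density, approximating \<open>T' v\<close> in the span of \<open>B\<close> and applying
  \<open>T\<close> approximates \<open>T (T' v) = v\<close>.\<close>

lemma orthonormal_basis_antiunitary_image:
  assumes T: "antilinear_isometry_between W W' T" and T': "antilinear_isometry_between W' W T'"
    and inv: "\<And>v. v \<in> W' \<Longrightarrow> T (T' v) = v" and sub: "complex_vector.subspace W" and W': "hilbert_subspace W'"
    and B: "orthonormal_basis W B"
  shows "orthonormal_basis W' (T ` B)" "inj_on T B"
proof -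
  have BW: "B \<subseteq> W" and clB: "closure (complex_vector.span B) = W"
    and orth: "\<And>u v. u \<in> B \<Longrightarrow> v \<in> B \<Longrightarrow> cinner u v = (if u = v then 1 else 0)"
    using B by (auto simp: orthonormal_basis_def)
  have cin: "cinner (T u) (T v) = cinner v u" if "u \<in> B" "v \<in> B" for u v
    using antilinear_isometry_cinner[OF T sub] BW that by blast
  show inj: "inj_on T B"
  proof (rule inj_onI)
    fix u v assume uv: "u \<in> B" "v \<in> B" "T u = T v"
    then have "cinner v u = cinner u u" using cin by metis
    then show "u = v" using orth uv(1,2) by (metis zero_neq_one)
  qed
  have TW: "T ` W \<subseteq> W'" using T by (simp add: antilinear_isometry_between_def)
  have "closure (complex_vector.span (T ` B)) = W'"
  proof
    have "T ` B \<subseteq> W'" using TW BW by blast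
    then show "closure (complex_vector.span (T ` B)) \<subseteq> W'"
      using W' unfolding hilbert_subspace_def by (intro closure_minimal complex_vector.span_minimal) auto
  next
    have span: "T u \<in> complex_vector.span (T ` B) \<and> u \<in> W" if "u \<in> complex_vector.span B" for u
      using that
    proof (induction rule: complex_vector.span_induct_alt)
      case base
      have "(0::'a) \<in> W" by (rule complex_vector.subspace_0[OF sub])
      with antilinear_isometry_betweenD(4)[OF T this] show ?case by (simp add: complex_vector.span_zero)
    next
      case (step a x y)
      have x: "x \<in> W" using step(1) BW by blast
      have y: "y \<in> W" using step(2) by blast
      have "T (a *\<^sub>C x + y) = cnj a *\<^sub>C T x + T y"
        using antilinear_isometry_betweenD(5)[OF T x y, of a 1] by simp
      moreover have "\<dots> \<in> complex_vector.span (T ` B)"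
        using step by (intro complex_vector.span_add complex_vector.span_scale) (auto intro: complex_vector.span_base)
      ultimately show ?case
        using complex_vector.subspace_add[OF sub complex_vector.subspace_scale[OF sub x] y] by simp
    qed
    show "W' \<subseteq> closure (complex_vector.span (T ` B))"
    proof
      fix v assume v: "v \<in> W'"
      have T'v: "T' v \<in> W" by (rule antilinear_isometry_betweenD(1)[OF T' v])
      then obtain q where q: "\<And>n. q n \<in> complex_vector.span B" "q \<longlonglongrightarrow> T' v"
        unfolding clB[symmetric] closure_sequential by metis
      have "norm (T (q n) - v) = norm (q n - T' v)" for n
      proof -
        have qn: "q n \<in> W" using span[OF q(1)] by blast
        have "q n - T' v \<in> W" by (rule complex_vector.subspace_diff[OF sub qn T'v])
        moreover have "T (q n - T' v) = T (q n) - v"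
          using antilinear_isometry_betweenD(5)[OF T qn T'v, of 1 "-1"] inv[OF v] by (simp add: scaleC_minus1)
        ultimately show ?thesis using antilinear_isometry_betweenD(4)[OF T] by metis
      qed
      then have "(\<lambda>n. T (q n)) \<longlonglongrightarrow> v"
        using q(2) by (simp only: tendsto_dist_iff[of _ v] tendsto_dist_iff[of _ "T' v"] dist_norm)
      moreover have "\<forall>n. T (q n) \<in> complex_vector.span (T ` B)" using span[OF q(1)] by blast
      ultimately show "v \<in> closure (complex_vector.span (T ` B))"
        unfolding closure_sequential by (intro exI[of _ "\<lambda>n. T (q n)"]) simp
    qed
  qed
  then show "orthonormal_basis W' (T ` B)"
    unfolding orthonormal_basis_def using TW BW inj orth cin by (auto simp: inj_on_eq_iff)
qed

text \<open>The two definite descriptions have the same predicate: bases are carried over in both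
  directions together with their cardinality.\<close>

lemma hilbert_dim_antiunitary:
  assumes T: "antilinear_isometry_between W W' T" and T': "antilinear_isometry_between W' W T'"
    and inv: "\<And>v. v \<in> W' \<Longrightarrow> T (T' v) = v" "\<And>v. v \<in> W \<Longrightarrow> T' (T v) = v"
    and W: "hilbert_subspace W" "hilbert_subspace W'"
  shows "hilbert_dim W = hilbert_dim W'"
proof -
  let ?d = "\<lambda>B. if finite B then enat (card B) else \<infinity>"
  have sub: "complex_vector.subspace W" "complex_vector.subspace W'"
    using W by (simp_all add: hilbert_subspace_def)
  have "(\<exists>B. orthonormal_basis W B \<and> d = ?d B) \<longleftrightarrow> (\<exists>B. orthonormal_basis W' B \<and> d = ?d B)" for d
  proof
    assume "\<exists>B. orthonormal_basis W B \<and> d = ?d B"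
    then obtain B where B: "orthonormal_basis W B" "d = ?d B" by blast
    note im = orthonormal_basis_antiunitary_image[OF T T' inv(1) sub(1) W(2) B(1)]
    then show "\<exists>B. orthonormal_basis W' B \<and> d = ?d B"
      using B(2) by (intro exI[of _ "T ` B"]) (simp add: card_image finite_image_iff)
  next
    assume "\<exists>B. orthonormal_basis W' B \<and> d = ?d B"
    then obtain B where B: "orthonormal_basis W' B" "d = ?d B" by blast
    note im = orthonormal_basis_antiunitary_image[OF T' T inv(2) sub(2) W(1) B(1)]
    then show "\<exists>B. orthonormal_basis W B \<and> d = ?d B"
      using B(2) by (intro exI[of _ "T' ` B"]) (simp add: card_image finite_image_iff)
  qed
  then show ?thesis unfolding hilbert_dim_def by simp
qed

text \<open>Pythagoras: if \<open>y\<close> is orthogonal to \<open>z - y\<close> and as long as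
  \<open>z\<close>, then \<open>z - y\<close> has length zero.\<close>

lemma eq_if_cinner_diff_zero:
  assumes "cinner y (z - y) = 0" "norm z = norm (y::'h::complex_hilbert_space)"
  shows "y = z"
proof -
  have "cinner y z = cinner y y" using assms(1) by (simp add: cinner_diff_right)
  then have "cinner z y = cinner y y" using cinner_commute[of z y] cinner_commute[of y y] by simp
  moreover have "cinner z z = cinner y y" using assms(2) by (simp add: cinner_self)
  ultimately have "cinner (z - y) (z - y) = 0" using assms(1) by (simp add: cinner_diff_left cinner_diff_right)
  then show ?thesis by (simp add: cinner_self)
qed

lemma span_range_scaleR:
  assumes "\<And>n. (w n :: real) \<noteq> 0"
  shows "complex_vector.span (range (\<lambda>n. w n *\<^sub>R u n)) = complex_vector.span (range (u :: nat \<Rightarrow> 'h::complex_hilbert_space))"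
proof (rule complex_vector.span_eq[THEN iffD2], intro conjI image_subsetI)
  show "w n *\<^sub>R u n \<in> complex_vector.span (range u)" for n
    unfolding scaleC_of_real[symmetric] by (intro complex_vector.span_scale complex_vector.span_base) simp
  show "u n \<in> complex_vector.span (range (\<lambda>n. w n *\<^sub>R u n))" for n
  proof -
    have "u n = complex_of_real (1 / w n) *\<^sub>C (w n *\<^sub>R u n)"
      using assms[of n] by (simp only: scaleC_of_real) simp
    also have "\<dots> \<in> complex_vector.span (range (\<lambda>n. w n *\<^sub>R u n))"
      by (intro complex_vector.span_scale complex_vector.span_base) simp
    finally show ?thesis .
  qed
qed

section \<open>Construction of the operators \<open>r x\<close>\<close>

context real_form
begin

lemma S_cinner:
  assumes p: "shift_density \<mu> 1 p" and f: "f \<in> L2" and g: "g \<in> L2"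
  shows "AE x in \<mu>. cinner (S f x) (S g x) = complex_of_real (p x) * cinner (g (check x)) (f (check x))"
proof -
  \<comment> \<open>In the second combination \<open>f\<close> and \<open>g\<close> change places:
    the image of \<i> g + f is -\<i> S g + S f, which has the norm of \<i> S f + S g.\<close>
  note lin1 = S_antilinear[OF f g, of 1 1] and lin2 = S_antilinear[OF g f, of \<i> 1]
  show ?thesis
    using lin1 lin2 S_norm_pointwise[OF p f] S_norm_pointwise[OF p g]
      S_norm_pointwise[OF p L2_combination[OF f g, of 1 1]] S_norm_pointwise[OF p L2_combination[OF g f, of \<i> 1]]
  proof eventually_elim
    case (elim x)
    have a: "(norm (S f x + S g x))\<^sup>2 = p x * (norm (g (check x) + f (check x)))\<^sup>2"
      using elim(1,5) by (simp add: add.commute)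
    have "norm (\<i> *\<^sub>C S f x + S g x) = norm ((- \<i>) *\<^sub>C (\<i> *\<^sub>C S f x + S g x))"
      by (simp only: norm_scaleC) simp
    also have "(- \<i>) *\<^sub>C (\<i> *\<^sub>C S f x + S g x) = (- \<i>) *\<^sub>C S g x + S f x"
      by (simp add: scaleC_add_right scaleC_scaleC)
    finally have b: "(norm (\<i> *\<^sub>C S f x + S g x))\<^sup>2 = p x * (norm (\<i> *\<^sub>C g (check x) + f (check x)))\<^sup>2"
      using elim(2,6) by simp
    show ?case
      unfolding cinner_norm_polarization[of "S f x"] cinner_norm_polarization[of "g (check x)"] a b elim(3,4)
      by (simp add: complex_eq_iff algebra_simps)
  qed
qed

text \<open>The values of \<open>r x\<close> are forced on the vectors \<open>F n (check x)\<close>.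
  By \<open>S_cinner\<close> the prescribed images have the transposed Gram matrix, so the
  antiunitary extension exists.\<close>

lemma family_of_real_structure:
  assumes p: "shift_density \<mu> 1 p"
  obtains r where "real_form_data r" "AE x in \<mu>. nu V (check x) = nu V x"
proof -
  have pm [measurable]: "p \<in> borel_measurable borel" and p0: "\<And>x. 0 \<le> p x"
    using p by (simp_all add: shift_density_def)
  note AE_check = AE_shift[OF p]
  define \<phi> where "\<phi> x = sqrt (p x)" for x
  have \<phi>m: "(\<lambda>x. 1 / \<phi> x) \<in> borel_measurable M"
    unfolding \<phi>_def by (rule borel_completion) measurable
  have \<phi>_pos: "AE x in \<mu>. 0 < \<phi> x"
    using shift_density_pos[OF p] by eventually_elim (simp add: \<phi>_def)
  have \<phi>2: "\<phi> x * \<phi> x = p x" for x by (simp add: \<phi>_def p0)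
  obtain w :: "nat \<Rightarrow> binseq \<Rightarrow> real" where w: "\<And>n. w n \<in> borel_measurable M" "\<And>n x. 0 < w n x"
    and F0: "\<And>n. (\<lambda>x. w n x *\<^sub>R e n x) \<in> L2"
    using fundamental_L2 by blast
  define F where "F n x = w n x *\<^sub>R e n x" for n x
  have F: "F n \<in> L2" for n unfolding F_def by (rule F0)
  have V_F: "V x = closure (complex_vector.span (range (\<lambda>n. F n x)))" for x
    unfolding V_eq F_def using w(2)[of _ x] by (subst span_range_scaleR) (simp_all add: less_imp_neq[symmetric])
  have F_V: "F n x \<in> V x" for n x
    unfolding F_def using e_in_V by (rule V_closed_arith)
  \<comment> \<open>Dividing by the square root of the density makes \<open>S\<close> isometric
    fibre by fibre.\<close>
  define T where "T f x = (1 / \<phi> x) *\<^sub>R S f x" for f x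
  have T_msec: "T f \<in> msec" if "f \<in> L2" for f
    unfolding T_def by (rule msec_scaleR[OF L2_msec[OF S_L2[OF that]] \<phi>m])
  have T_cinner: "AE x in \<mu>. cinner (T f x) (T g x) = cinner (g (check x)) (f (check x))"
    if "f \<in> L2" "g \<in> L2" for f g
    using S_cinner[OF p that] \<phi>_pos
  proof eventually_elim
    case (elim x)
    have "cinner (T f x) (T g x) = complex_of_real (1 / \<phi> x * (1 / \<phi> x)) * cinner (S f x) (S g x)"
      by (simp add: T_def cinner_scaleC_left cinner_scaleC_right flip: scaleC_of_real)
    also have "\<dots> = complex_of_real (1 / \<phi> x * (1 / \<phi> x) * p x) * cinner (g (check x)) (f (check x))"
      by (simp only: elim(1) of_real_mult mult.assoc)
    also have "1 / \<phi> x * (1 / \<phi> x) * p x = 1"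
      using elim(2) by (simp flip: \<phi>2)
    finally show ?case by (simp only: of_real_1 mult_1_left)
  qed
  \<comment> \<open>A priori the vectors \<open>T (F n) x\<close> span only a subspace of
    \<open>V x\<close>; surjectivity of \<open>r x\<close> comes later, from its involution
    property.\<close>
  define G where "G x = closure (complex_vector.span (range (\<lambda>n. T (F n) x)))" for x
  define good where "good x R \<longleftrightarrow> antilinear_isometry_between (V (check x)) (G x) R \<and>
      (\<forall>v\<in>V (check x). \<forall>n. cinner (T (F n) x) (R v) = cinner v (F n (check x))) \<and>
      (\<forall>n. R (F n (check x)) = T (F n) x)" for x R
  \<comment> \<open>The choice is made separately at each point; measurability is not built in and
    is derived in \<open>r_msec\<close>.\<close>
  define r where "r x = (SOME R. good x R)" for x
  have "AE x in \<mu>. \<forall>m n. cinner (T (F m) x) (T (F n) x) = cinner (F n (check x)) (F m (check x))"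
    unfolding AE_all_countable using T_cinner[OF F F] by blast
  then have good: "AE x in \<mu>. good x (r x)"
  proof eventually_elim
    case (elim x)
    then have "\<exists>R. good x R"
      using antiunitary_extension[of "\<lambda>n. T (F n) x" "\<lambda>n. F n (check x)"]
      unfolding good_def V_F[of "check x"] G_def by blast
    then show ?case unfolding r_def by (rule someI_ex)
  qed
  have "AE x in \<mu>. \<forall>n. T (F n) x \<in> V x"
    unfolding AE_all_countable using msec_in_V[OF T_msec[OF F]] by blast
  then have G_V: "AE x in \<mu>. G x \<subseteq> V x"
  proof eventually_elim
    case (elim x)
    then show ?case
      unfolding G_def using family subspace_V
      by (intro closure_minimal complex_vector.span_minimal) (auto simp: measurable_family_def hilbert_subspace_def)
  qed
  have r_anti: "AE x in \<mu>. antilinear_isometry_between (V (check x)) (V x) (r x)"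
    using good G_V by eventually_elim (auto simp: good_def antilinear_isometry_between_def)
  \<comment> \<open>\<open>T f x\<close> is not yet known to lie in \<open>G x\<close>. Its inner
    products with the spanning vectors show that \<open>r x (f (check x))\<close> is its projection
    to \<open>G x\<close>, and equality of norms then gives equality.\<close>
  have r_eq: "AE x in \<mu>. r x (f (check x)) = T f x" if f: "f \<in> L2" for f
  proof -
    have "AE x in \<mu>. \<forall>n. cinner (T (F n) x) (T f x) = cinner (f (check x)) (F n (check x))"
      unfolding AE_all_countable using T_cinner[OF F f] by blast
    then show ?thesis
      using good AE_check[OF msec_in_V[OF L2_msec[OF f]]] T_cinner[OF f f]
    proof eventually_elim
      case (elim x)
      let ?y = "r x (f (check x))"
      have anti: "antilinear_isometry_between (V (check x)) (G x) (r x)" using elim(2) by (simp add: good_def)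
      have y: "?y \<in> G x" by (rule antilinear_isometry_betweenD(1)[OF anti elim(3)])
      have "cinner (T (F n) x) ?y = cinner (f (check x)) (F n (check x))" for n
        using elim(2,3) unfolding good_def by blast
      then have "cinner b (T f x - ?y) = 0" if "b \<in> range (\<lambda>n. T (F n) x)" for b
        using elim(1) that by (auto simp only: cinner_diff_right right_minus_eq)
      then have "cinner ?y (T f x - ?y) = 0"
        using y unfolding G_def by (rule cinner_zero_on_closure_span)
      moreover have "norm (T f x) = norm ?y"
        using elim(4) antilinear_isometry_betweenD(4)[OF anti elim(3)]
        unfolding cinner_self of_real_eq_iff by (metis norm_ge_zero power2_eq_iff_nonneg)
      ultimately show ?case by (rule eq_if_cinner_diff_zero)
    qed
  qed
  have \<phi>_inv: "AE x in \<mu>. \<phi> x * \<phi> (check x) = 1"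
    using shift_density_involution[OF p]
    by eventually_elim (simp add: \<phi>_def mult.commute flip: real_sqrt_mult)
  have "AE x in \<mu>. \<forall>n. r x (r (check x) (F n x)) = F n x"
    unfolding AE_all_countable
  proof
    fix n
    show "AE x in \<mu>. r x (r (check x) (F n x)) = F n x"
      \<comment> \<open>\<open>r_eq\<close> is needed for \<open>S (F n)\<close> as well, a section
        outside the chosen countable family; this is why it was proved for all of
        \<open>L2\<close>.\<close>
      using r_anti AE_check[OF r_eq[OF F[of n]]] r_eq[OF S_L2[OF F[of n]]] S_involution[OF F[of n]] \<phi>_inv
        AE_check[OF msec_in_V[OF L2_msec[OF S_L2[OF F[of n]]]]]
    proof eventually_elim
      case (elim x)
      have "r (check x) (F n x) = (1 / \<phi> (check x)) *\<^sub>R S (F n) (check x)"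
        using elim(2) by (simp only: T_def binseq_add_cancel)
      then have "r x (r (check x) (F n x)) = (1 / \<phi> (check x)) *\<^sub>R T (S (F n)) x"
        by (simp only: antilinear_isometry_betweenD(3)[OF elim(1,6)] elim(3))
      also have "\<dots> = (1 / (\<phi> x * \<phi> (check x))) *\<^sub>R F n x"
        by (simp add: T_def elim(4) mult.commute)
      finally show ?case by (simp only: elim(5)) simp
    qed
  qed
  then have r_inv: "AE x in \<mu>. \<forall>v\<in>V x. r x (r (check x) v) = v"
    using r_anti AE_check[OF r_anti]
  proof eventually_elim
    case (elim x)
    have anti': "antilinear_isometry_between (V x) (V (check x)) (r (check x))"
      using elim(3) by (simp only: binseq_add_cancel)
    note in1 = antilinear_isometry_betweenD(1)[OF anti'] and in2 = antilinear_isometry_betweenD(1)[OF elim(2)]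
    show ?case
    proof
      fix v assume v: "v \<in> V x"
      have "cinner (F n x) (r x (r (check x) v)) = cinner (F n x) v" for n
      proof -
        have "cinner (F n x) (r x (r (check x) v)) = cinner (r x (r (check x) (F n x))) (r x (r (check x) v))"
          using elim(1) by simp
        also have "\<dots> = cinner (r (check x) v) (r (check x) (F n x))"
          by (rule antilinear_isometry_cinner[OF elim(2) subspace_V in1[OF F_V] in1[OF v]])
        also have "\<dots> = cinner (F n x) v"
          by (rule antilinear_isometry_cinner[OF anti' subspace_V v F_V])
        finally show ?thesis .
      qed
      then show "r x (r (check x) v) = v"
        using v in2[OF in1[OF v]] unfolding V_F[of x]
        by (intro closure_span_eqI[of _ "range (\<lambda>n. F n x)"]) auto
    qed
  qed
  \<comment> \<open>Since \<open>r x\<close> is antiunitary with inverse \<open>r (check x)\<close>,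
    testing against \<open>F n x\<close> moves the operator to the other side: the result is a
    translate of the inner product of \<open>f\<close> with \<open>T (F n)\<close>, and translations
    preserve measurability.\<close>
  have r_msec: "(\<lambda>x. r x (f (check x))) \<in> msec" if f: "f \<in> msec" for f
    unfolding msections_def
  proof (intro CollectI conjI allI)
    show "AE x in \<mu>. r x (f (check x)) \<in> V x"
      using r_anti AE_check[OF msec_in_V[OF f]]
      by eventually_elim (rule antilinear_isometry_betweenD(1))
    fix n
    have "(\<lambda>x. cinner (f x) (T (F n) x)) \<in> borel_measurable M"
      by (rule msec_cinner[OF f T_msec[OF F]])
    then have "(\<lambda>x. cinner (f (check x)) (T (F n) (check x))) \<in> borel_measurable M"
      by (rule measurable_completion_shift[OF p])
    then have "(\<lambda>x. complex_of_real (1 / w n x) * cinner (f (check x)) (T (F n) (check x))) \<in> borel_measurable M"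
      using w(1)[of n] by measurable
    then show "(\<lambda>x. cinner (e n x) (r x (f (check x)))) \<in> borel_measurable M"
    proof (rule measurable_completion_AE_cong)
      show "AE x in \<mu>. complex_of_real (1 / w n x) * cinner (f (check x)) (T (F n) (check x)) = cinner (e n x) (r x (f (check x)))"
        using r_anti AE_check[OF r_anti] r_inv AE_check[OF r_eq[OF F[of n]]] AE_check[OF msec_in_V[OF f]]
      proof eventually_elim
        case (elim x)
        have anti': "antilinear_isometry_between (V x) (V (check x)) (r (check x))"
          using elim(2) by (simp only: binseq_add_cancel)
        have rF: "r (check x) (F n x) = T (F n) (check x)" using elim(4) by (simp only: binseq_add_cancel)
        have en: "e n x = (1 / w n x) *\<^sub>R F n x" using w(2)[of n x] by (simp add: F_def)
        have "cinner (F n x) (r x (f (check x))) = cinner (r x (r (check x) (F n x))) (r x (f (check x)))"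
          using elim(3) F_V by simp
        also have "\<dots> = cinner (f (check x)) (r (check x) (F n x))"
          by (rule antilinear_isometry_cinner[OF elim(1) subspace_V antilinear_isometry_betweenD(1)[OF anti' F_V] elim(5)])
        finally show ?case
          by (simp only: en rF cinner_scaleC_left complex_cnj_complex_of_real flip: scaleC_of_real)
      qed
    qed simp
  qed
  have r_comm: "AE x in \<mu>. \<forall>v\<in>V (check x). r x (c k (check x) v) = (-1) ^ k *\<^sub>C c k x (r (x + delta k) v)"
    if k: "1 \<le> k" for k
  proof -
    \<comment> \<open>The vectors are \<open>F n\<close> at \<open>check x + delta k\<close> because
      \<open>J'\<close> applied to \<open>F n\<close> reads them there when evaluated at
      \<open>check x\<close>.\<close>
    have "AE x in \<mu>. \<forall>n. r x (c k (check x) (F n (check x + delta k)))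
        = (-1) ^ k *\<^sub>C c k x (r (x + delta k) (F n (check x + delta k)))"
      unfolding AE_all_countable
    proof
      fix n
      show "AE x in \<mu>. r x (c k (check x) (F n (check x + delta k)))
          = (-1) ^ k *\<^sub>C c k x (r (x + delta k) (F n (check x + delta k)))"
        using r_anti AE_delta[OF r_anti, of k] r_eq[OF J'_L2[OF k F[of n]]] S_J'[OF k F[of n]]
          AE_delta[OF r_eq[OF F[of n]], of k] c_unitary[OF k] AE_check[OF c_unitary[OF k]]
          V_delta[of k] AE_check[OF V_delta[of k]] shift_density_commute[OF s_density[of k] p]
          \<phi>_pos AE_delta[OF \<phi>_pos, of k] AE_check[OF s_pos[of k]]
      proof eventually_elim
        case (elim x)
        have swap: "check (x + delta k) = check x + delta k" by (simp add: ac_simps)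
        define v where "v = F n (check x + delta k)"
        define y where "y = check x"
        have v: "v \<in> V y" using F_V[of n "check x + delta k"] elim(9) by (simp add: v_def y_def)
        have cu: "unitary_between (V y) (V y) (c k y)" using elim(7) by (simp add: y_def)
        have ra: "antilinear_isometry_between (V y) (V x) (r x)" using elim(1) by (simp add: y_def)
        have cv: "c k y v \<in> V y" by (rule unitary_betweenD(1)[OF cu v])
        have rv: "r (x + delta k) v \<in> V x"
          using antilinear_isometry_betweenD(1)[OF elim(2), of v] v elim(8,9) by (simp add: swap y_def)
        have Sv: "S (F n) (x + delta k) = \<phi> (x + delta k) *\<^sub>R r (x + delta k) v"
          using elim(5,12) unfolding swap v_def[symmetric] by (simp add: T_def)
        have sq: "\<phi> x * s k y = s k x * \<phi> (x + delta k)"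
        proof -
          have "sqrt ((s k y)\<^sup>2 * p x) = sqrt (p (x + delta k) * (s k x)\<^sup>2)" using elim(10) by (simp add: y_def)
          then show ?thesis by (simp add: real_sqrt_mult s_nonneg mult.commute \<phi>_def)
        qed
        have par: "parity_sign k y = (-1) ^ k * parity_sign k x" unfolding y_def by (rule parity_sign_check)
        have "(parity_sign k y * s k y) *\<^sub>C r x (c k y v) = r x (J' \<mu> c k (F n) y)"
        proof -
          have "J' \<mu> c k (F n) y = (parity_sign k y * s k y) *\<^sub>C c k y v"
            by (simp only: J'_def y_def[symmetric] v_def[symmetric] scaleC_of_real[symmetric]
                unitary_betweenD(2)[OF cu v, folded v_def] scaleC_scaleC v_def[folded y_def, symmetric])
          then show ?thesis
            by (simp add: antilinear_isometry_betweenD(2)[OF ra cv] cnj_parity_sign)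
        qed
        also have "\<dots> = (1 / \<phi> x) *\<^sub>R J' \<mu> c k (S (F n)) x"
          using elim(3,4) by (simp add: T_def y_def)
        also have "\<dots> = (parity_sign k x * (1 / \<phi> x * (s k x * \<phi> (x + delta k)))) *\<^sub>C c k x (r (x + delta k) v)"
          by (simp only: J'_def Sv scaleC_of_real[symmetric] scaleC_scaleC unitary_betweenD(2)[OF elim(6) rv] of_real_mult ac_simps)
        also have "1 / \<phi> x * (s k x * \<phi> (x + delta k)) = s k y"
          using elim(11) by (simp flip: sq)
        finally have eq: "(parity_sign k y * s k y) *\<^sub>C r x (c k y v) = (parity_sign k x * s k y) *\<^sub>C c k x (r (x + delta k) v)" .
        have sy: "s k y \<noteq> 0" using elim(13) by (simp add: y_def)
        \<comment> \<open>Multiplying by this scalar removes the nonzero derivative factor and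
          leaves the product of the parity signs at \<open>y\<close> and \<open>x\<close>, which is
          (-1)^k.\<close>
        have one: "(parity_sign k y / s k y) * (parity_sign k y * s k y) = 1"
          using sy parity_sign_square[of k y] by simp
        have two: "(parity_sign k y / s k y) * (parity_sign k x * s k y) = (-1) ^ k"
          using sy parity_sign_square[of k x] by (simp add: par mult.assoc)
        from arg_cong[OF eq, of "\<lambda>u. (parity_sign k y / s k y) *\<^sub>C u"]
        have "r x (c k y v) = (-1) ^ k *\<^sub>C c k x (r (x + delta k) v)"
          by (simp only: scaleC_scaleC one two complex_vector.scale_one)
        then show ?case by (simp only: y_def v_def)
      qed
    qed
    then show ?thesis
      using r_anti AE_delta[OF r_anti, of k] c_unitary[OF k] AE_check[OF c_unitary[OF k]]
        V_delta[of k] AE_check[OF V_delta[of k]]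
    proof eventually_elim
      case (elim x)
      have swap: "check (x + delta k) = check x + delta k" by (simp add: ac_simps)
      have anti2: "antilinear_isometry_between (V (check x)) (V x) (r (x + delta k))"
        using elim(3) unfolding swap elim(6,7) .
      have lhs: "antilinear_isometry_between (V (check x)) (V x) (\<lambda>v. r x (c k (check x) v))"
        by (rule antilinear_isometry_unitary[OF elim(5,2)])
      have rhs: "antilinear_isometry_between (V (check x)) (V x) (\<lambda>v. (-1) ^ k *\<^sub>C c k x (r (x + delta k) v))"
        by (rule unitary_antilinear_isometry[OF anti2 elim(4) subspace_V]) (simp_all add: norm_power)
      \<comment> \<open>Almost everywhere the fibres at \<open>check x + delta k\<close> and
        \<open>check x\<close> coincide, so the translated vectors span the required fibre.\<close>
      have span: "V (check x) = closure (complex_vector.span (range (\<lambda>n. F n (check x + delta k))))"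
        using V_F[of "check x + delta k"] unfolding elim(7) .
      show ?case
        using antilinear_isometries_eq_on_closure_span[OF lhs rhs span] elim(1) by blast
    qed
  qed
  have "real_form_data r"
    unfolding real_form_data_def check_antilinear_family_def using r_anti r_msec r_inv r_comm by blast
  moreover have "AE x in \<mu>. nu V (check x) = nu V x"
    using r_anti AE_check[OF r_anti] r_inv AE_check[OF r_inv]
  proof eventually_elim
    case (elim x)
    have "hilbert_subspace (V z)" for z using family by (simp add: measurable_family_def)
    moreover have "antilinear_isometry_between (V x) (V (check x)) (r (check x))"
      using elim(2) by (simp only: binseq_add_cancel)
    moreover have "\<forall>v\<in>V (check x). r (check x) (r x v) = v"
      using elim(4) by (simp only: binseq_add_cancel)
    ultimately show ?case
      using elim(1,3) by (intro hilbert_dim_antiunitary[of _ _ "r x" "r (check x)"]) auto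
  qed
  ultimately show thesis by (rule that)
qed

end

theorem theorem3p2:
  fixes \<mu> :: "binseq measure"
    and V :: "binseq \<Rightarrow> 'h::complex_hilbert_space set"
    and e :: "nat \<Rightarrow> binseq \<Rightarrow> 'h"
    and c :: "nat \<Rightarrow> binseq \<Rightarrow> 'h \<Rightarrow> 'h"
  assumes "GW_triple \<mu> V e c"
  shows "admits_invariant_real_form \<mu> V e c \<longleftrightarrow>
    equivalent_measures \<mu> (check_measure \<mu>) \<and>
    (AE x in \<mu>. nu V (check x) = nu V x) \<and>
    (\<exists>r. check_antilinear_family \<mu> V e r \<and>
      (AE x in \<mu>. \<forall>v\<in>V x. r x (r (check x) v) = v) \<and>
      (\<forall>k\<ge>1. AE x in \<mu>. \<forall>v\<in>V (check x).
        r x (c k (check x) v) = (-1) ^ k *\<^sub>C c k x (r (x + delta k) v)))"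
proof -
  interpret gw_triple \<mu> V e c by (rule gw_triple.intro[OF assms])
  show ?thesis
    unfolding real_form_data_def[symmetric]
  proof
    assume "admits_invariant_real_form \<mu> V e c"
    then obtain S where S: "real_structure \<mu> V e c S" unfolding admits_invariant_real_form_def by blast
    interpret real_form \<mu> V e c S by unfold_locales (rule S)
    obtain p where p: "shift_density \<mu> 1 p" using check_density_exists by blast
    from family_of_real_structure[OF p] equivalent_translate[OF p]
    show "equivalent_measures \<mu> (check_measure \<mu>) \<and> (AE x in \<mu>. nu V (check x) = nu V x) \<and>
        (\<exists>r. real_form_data r)" by blast
  next
    assume *: "equivalent_measures \<mu> (check_measure \<mu>) \<and> (AE x in \<mu>. nu V (check x) = nu V x) \<and>
        (\<exists>r. real_form_data r)"
    then obtain p where "shift_density \<mu> 1 p"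
      unfolding equivalent_measures_def has_derivative_wrt_translate by blast
    with * show "admits_invariant_real_form \<mu> V e c"
      unfolding admits_invariant_real_form_def using real_structure_of_family by blast
  qed
qed

end
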